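(* (i) Let $S\equiv\pm\{1, 3, 4, 5, 6, 7, 13, 15, 16, 17, 18, 19\}\pmod{40}$ and $T\equiv\pm\{1, 2, 3, 5, 9, 11, 12, 15, 16, 17, 18, 19\}\pmod{40}$. Then $p(S,n)=p(T,n-1)$ for all $n\geq 1$. (ii) Let $S\equiv\pm\{3, 4, 5, 6, 7, 8, 9, 11, 13, 14, 15, 17\}\pmod{40}$ and $T\equiv\pm\{1, 3, 5, 8, 9, 11, 12, 14, 15, 17, 18, 19\}\pmod{40}$. Then $p(S,n)=p(T,n-3)$ for all $n\geq 3$. (iii) Let $S\equiv\pm\{1, 3, 4, 5, 6, 7, 8, 13, 14, 15, 17, 19\}\pmod{40}$ and $T\equiv\pm\{1, 2, 5, 6, 7, 8, 9, 11, 12, 13, 15, 19\}\pmod{40}$. Then $p(S,n)=p(T,n)$ for all integers $n\ge 0$ with $n\neq 2$. (iv) Let $S\equiv\pm\{2, 3, 4, 5, 7, 9, 11, 13, 14, 15, 16, 17\}\pmod{40}$ and $T\equiv\pm\{1, 2, 5, 7, 9, 11, 12, 13, 15, 16, 18, 19\}\pmod{40}$. Then $p(S,n)=p(T,n-2)$ for all $n\geq 2$.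
   Context: For a set $S$ of positive integers and an integer $n\ge 0$, $p(S,n)$ denotes the number of partitions of $n$ into parts belonging to $S$ (so $p(S,0)=1$). The notation $S\equiv\pm\{r_1,\dots,r_k\}\pmod M$ means that $S$ is the set of all positive integers $n$ such that $n\equiv r_i$ or $n\equiv -r_i\pmod M$ for some $i$. *)

theory Defs
  imports "HOL-Library.Multiset" "HOL-Number_Theory.Cong"
begin

text \<open>A partition is the multiset of its parts. The count is meaningful for sets \<open>S\<close> of
  positive integers: if \<open>0 \<in> S\<close> the set of multisets is infinite whenever it is nonempty, and
  \<open>card\<close> returns \<open>0\<close>.\<close>

definition partition_count :: "nat set \<Rightarrow> nat \<Rightarrow> nat" where
  "partition_count S n = card {P :: nat multiset. set_mset P \<subseteq> S \<and> sum_mset P = n}"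

definition pm_residues :: "int set \<Rightarrow> int \<Rightarrow> nat set" where
  "pm_residues R M =
     {n. 0 < n \<and> (\<exists>r\<in>R. [int n = r] (mod M) \<or> [int n = - r] (mod M))}"

end

theory Submission
  imports Defs "HOL-Complex_Analysis.Complex_Analysis" "HOL-Library.Nat_Bijection"
begin

text \<open>Each part says that two infinite products \<open>F\<^sub>S\<close>, \<open>F\<^sub>T\<close> satisfy \<open>F\<^sub>S - q\<^sup>k F\<^sub>T = \<plusminus> q\<^sup>j\<close>. Clearing
  denominators gives an identity between theta functions of nome \<open>q\<^sup>4\<^sup>0\<close> in which the odd residues pair up
  into theta functions \<open>c k = \<theta>(q\<^sup>k; q\<^sup>2\<^sup>0)\<close>. Together with the image under \<open>q \<mapsto> -q\<close>, where \<open>c k\<close> turns into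
  \<open>d k = \<theta>(-q\<^sup>k; q\<^sup>2\<^sup>0)\<close> for odd \<open>k\<close>, it becomes a linear system whose solution rests on two kinds of
  relations: quartic ones such as
  \<open>c 1 * c 3 * c 5 * c 9 + d 1 * d 3 * d 5 * d 9 = \<theta>(-1; q\<^sup>2\<^sup>0) * d 4 * d 6 * d 8\<close>, and quadratic ones such as
  \<open>c 9 * d 7 + d 9 * c 7 = \<theta>(-1; q\<^sup>2\<^sup>0) * c 8 * d 8 * c 9 * d 9\<close>. Both are specialisations of the Weierstrass
  three-term relation, which follows from the Jacobi triple product.\<close>

section \<open>Theta functions\<close>

definition qpoch :: "complex \<Rightarrow> complex \<Rightarrow> complex" where
  "qpoch z p = (\<Prod>k. 1 - z * p ^ k)"

lemma has_prod_qpoch: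
  assumes "norm p < 1"
  shows "(\<lambda>k. 1 - z * p ^ k) has_prod qpoch z p"
proof -
  have "summable (\<lambda>k. norm ((1 - z * p ^ k) - 1))"
    using assms by (auto simp: norm_mult norm_power intro!: summable_mult summable_geometric)
  then have "convergent_prod (\<lambda>k. 1 - z * p ^ k)"
    using abs_convergent_prod_imp_convergent_prod abs_convergent_prod_conv_summable by blast
  then show ?thesis
    unfolding qpoch_def by (rule convergent_prod_has_prod)
qed

lemma qpoch_LIMSEQ:
  assumes "norm p < 1"
  shows "(\<lambda>n. \<Prod>k<n. 1 - z * p ^ k) \<longlonglongrightarrow> qpoch z p"
  using has_prod_imp_tendsto'[OF has_prod_qpoch[OF assms]] .

lemma qpoch_nonzero:
  assumes "norm p < 1" "norm z < 1"
  shows "qpoch z p \<noteq> 0"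
proof
  assume "qpoch z p = 0"
  then obtain k where k: "1 - z * p ^ k = 0"
    using has_prod_qpoch[OF assms(1), of z] by (auto simp: has_prod_eq_0_iff)
  have "norm (z * p ^ k) \<le> norm z * 1"
    unfolding norm_mult norm_power using assms by (intro mult_left_mono power_le_one) auto
  with assms k show False by auto
qed

lemma prod_lessThan_double: "(\<Prod>k<2 * n. f k) = (\<Prod>k<n. f (2 * k) * f (2 * k + 1 :: nat))"
  for f :: "nat \<Rightarrow> 'a :: comm_monoid_mult"
  by (induction n) (simp_all add: mult.assoc)

text \<open>Even and odd indices \<open>k\<close> are collected separately, each giving a product in
  \<open>p^2\<close>.\<close>

lemma qpoch_split:
  assumes "norm p < 1"
  shows "qpoch z p = qpoch z (p\<^sup>2) * qpoch (z * p) (p\<^sup>2)"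
proof (rule LIMSEQ_unique)
  have p2: "norm (p\<^sup>2) < 1"
    using assms by (simp add: norm_power power_less_one_iff)
  show "(\<lambda>n. \<Prod>k<2 * n. 1 - z * p ^ k) \<longlonglongrightarrow> qpoch z p"
    by (rule filterlim_compose[OF qpoch_LIMSEQ[OF assms]])
       (rule filterlim_subseq, simp add: strict_mono_def)
  have "(\<Prod>k<2 * n. 1 - z * p ^ k) =
      (\<Prod>k<n. 1 - z * (p\<^sup>2) ^ k) * (\<Prod>k<n. 1 - z * p * (p\<^sup>2) ^ k)" for n
    unfolding prod_lessThan_double prod.distrib by (simp add: power_mult mult.assoc)
  then show "(\<lambda>n. \<Prod>k<2 * n. 1 - z * p ^ k) \<longlonglongrightarrow> qpoch z (p\<^sup>2) * qpoch (z * p) (p\<^sup>2)"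
    by (auto intro!: tendsto_mult qpoch_LIMSEQ p2)
qed

text \<open>Factor by factor this is (1 - w) (1 + w) = 1 - w^2 with
  \<open>w = z * p ^ k\<close>.\<close>

lemma qpoch_mult_minus:
  assumes "norm p < 1"
  shows "qpoch z p * qpoch (- z) p = qpoch (z\<^sup>2) (p\<^sup>2)"
proof (rule LIMSEQ_unique)
  have p2: "norm (p\<^sup>2) < 1"
    using assms by (simp add: norm_power power_less_one_iff)
  show "(\<lambda>n. \<Prod>k<n. 1 - z\<^sup>2 * (p\<^sup>2) ^ k) \<longlonglongrightarrow> qpoch (z\<^sup>2) (p\<^sup>2)"
    by (rule qpoch_LIMSEQ[OF p2])
  have "(\<Prod>k<n. 1 - z\<^sup>2 * (p\<^sup>2) ^ k) = (\<Prod>k<n. 1 - z * p ^ k) * (\<Prod>k<n. 1 - (- z) * p ^ k)" for n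
    unfolding prod.distrib[symmetric]
    by (rule prod.cong) (auto simp: algebra_simps power2_eq_square power_mult_distrib)
  then show "(\<lambda>n. \<Prod>k<n. 1 - z\<^sup>2 * (p\<^sup>2) ^ k) \<longlonglongrightarrow> qpoch z p * qpoch (- z) p"
    using tendsto_mult[OF qpoch_LIMSEQ[OF assms, of z] qpoch_LIMSEQ[OF assms, of "- z"]] by simp
qed

text \<open>The product side of the Jacobi triple product without its factor
  \<open>qpoch p p\<close>; it is symmetric under exchanging \<open>z\<close> and
  \<open>p / z\<close>.\<close>

definition theta :: "complex \<Rightarrow> complex \<Rightarrow> complex" where
  "theta z p = qpoch z p * qpoch (p / z) p"

lemma theta_nonzero:
  assumes "norm p < 1" "norm p < norm z" "norm z < 1"
  shows "theta z p \<noteq> 0"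
proof -
  have "norm (p / z) < 1"
    using assms by (simp add: norm_divide divide_less_eq)
  with assms show ?thesis
    by (simp add: theta_def qpoch_nonzero)
qed

lemma theta_reflect: "p \<noteq> 0 \<Longrightarrow> theta (p / z) p = theta z p"
  by (simp add: theta_def)

lemma qpoch_head:
  assumes "norm p < 1"
  shows "qpoch z p = (1 - z) * qpoch (z * p) p"
proof (rule LIMSEQ_unique)
  show "(\<lambda>n. \<Prod>k<Suc n. 1 - z * p ^ k) \<longlonglongrightarrow> qpoch z p"
    using qpoch_LIMSEQ[OF assms] by (rule LIMSEQ_Suc)
  show "(\<lambda>n. \<Prod>k<Suc n. 1 - z * p ^ k) \<longlonglongrightarrow> (1 - z) * qpoch (z * p) p"
    unfolding prod.lessThan_Suc_shift
    using tendsto_mult_left[OF qpoch_LIMSEQ[OF assms, of "z * p"], of "1 - z"]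
    by (simp add: mult.assoc)
qed

text \<open>The two sides differ only in their head factors, and 1 - 1/z = - (1 - z) / z.\<close>

lemma theta_inverse:
  assumes "norm p < 1" "z \<noteq> 0"
  shows "theta (inverse z) p = - theta z p / z"
proof -
  have "theta (inverse z) p = (1 - inverse z) * qpoch (p / z) p * qpoch (z * p) p"
    using qpoch_head[OF assms(1), of "inverse z"] by (simp add: theta_def divide_inverse mult_ac)
  also have "\<dots> = - ((1 - z) * qpoch (z * p) p) * qpoch (p / z) p / z"
    using assms by (simp add: field_simps)
  finally show ?thesis
    by (simp add: theta_def qpoch_head[OF assms(1), of z])
qed

text \<open>Splitting both factors yields four products in \<open>p^2\<close> with arguments z, z p,
  p/z, p^2/z; pairing those whose arguments multiply to \<open>p^2\<close> gives two theta
  functions.\<close>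

lemma theta_split:
  assumes "norm p < 1" "p \<noteq> 0"
  shows "theta z p = theta z (p\<^sup>2) * theta (p / z) (p\<^sup>2)"
proof -
  have "p\<^sup>2 / (p / z) = z * p" "p / z * p = p\<^sup>2 / z"
    using assms by (simp_all add: power2_eq_square)
  then show ?thesis
    using qpoch_split[OF assms(1), of z] qpoch_split[OF assms(1), of "p / z"]
    by (simp only: theta_def mult_ac)
qed

lemma theta_mult_minus:
  assumes "norm p < 1"
  shows "theta z p * theta (- z) p = theta (z\<^sup>2) (p\<^sup>2)"
  using qpoch_mult_minus[OF assms, of z] qpoch_mult_minus[OF assms, of "p / z"]
  by (simp add: theta_def power_divide algebra_simps)

section \<open>Gaussian binomial coefficients and the q-binomial theorem\<close>

definition qfact :: "complex \<Rightarrow> nat \<Rightarrow> complex" where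
  "qfact p n = (\<Prod>k<n. 1 - p ^ Suc k)"

lemma qfact_nonzero:
  assumes "norm p < 1"
  shows "qfact p n \<noteq> 0"
proof -
  have "p ^ Suc k \<noteq> 1" for k
    using assms power_Suc_less_one[of "norm p" k]
    by (metis less_irrefl norm_ge_zero norm_one norm_power power_less_one_iff zero_less_Suc)
  then show ?thesis
    by (auto simp: qfact_def)
qed

lemma qfact_LIMSEQ:
  assumes "norm p < 1"
  shows "qfact p \<longlonglongrightarrow> qpoch p p"
  using qpoch_LIMSEQ[OF assms, of p] by (simp add: qfact_def[abs_def])

definition qbin :: "complex \<Rightarrow> nat \<Rightarrow> nat \<Rightarrow> complex" where
  "qbin p n k = (if k \<le> n then qfact p n / (qfact p k * qfact p (n - k)) else 0)"

text \<open>The q-Pascal rule, from 1 - p^(n+1) = (1 - p^(n-k)) + p^(n-k) (1 - p^(k+1)). The case k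
  = n stands apart because there \<open>qbin p n (Suc k)\<close> takes its default value 0.\<close>

lemma qbin_Suc_Suc:
  assumes "norm p < 1" "k \<le> n"
  shows "qbin p (Suc n) (Suc k) = qbin p n (Suc k) + p ^ (n - k) * qbin p n k"
proof (cases "k = n")
  case True
  then show ?thesis
    using qfact_nonzero[OF assms(1), of 0] qfact_nonzero[OF assms(1), of n]
      qfact_nonzero[OF assms(1), of "Suc n"] by (simp add: qbin_def qfact_def)
next
  case False
  then obtain d where d: "n = Suc (k + d)"
    using assms(2) by (metis add_Suc_right le_neq_implies_less less_imp_Suc_add)
  have nz: "qfact p (Suc m) = qfact p m * (1 - p ^ Suc m)" "qfact p m \<noteq> 0" "1 - p ^ Suc m \<noteq> 0" for m
    using qfact_nonzero[OF assms(1), of m] qfact_nonzero[OF assms(1), of "Suc m"]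
    by (auto simp: qfact_def)
  have n1: "1 - p ^ Suc n = (1 - p ^ Suc d) + p ^ Suc d * (1 - p ^ Suc k)"
    by (simp add: d power_add algebra_simps)
  have "qbin p (Suc n) (Suc k) = qfact p n * (1 - p ^ Suc n) /
      (qfact p k * (1 - p ^ Suc k) * (qfact p d * (1 - p ^ Suc d)))"
    using d nz(1)[of n] nz(1)[of k] nz(1)[of d] by (simp add: qbin_def Suc_diff_le)
  also have "\<dots> = qfact p n / (qfact p k * (1 - p ^ Suc k) * qfact p d) +
      p ^ Suc d * (qfact p n / (qfact p k * (qfact p d * (1 - p ^ Suc d))))"
    unfolding n1 using nz(2)[of k] nz(2)[of d] nz(3)[of k] nz(3)[of d]
    by (simp add: divide_simps del: power_Suc) (simp add: algebra_simps)
  also have "\<dots> = qbin p n (Suc k) + p ^ (n - k) * qbin p n k"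
    using d nz(1)[of k] nz(1)[of d] by (simp add: qbin_def Suc_diff_le)
  finally show ?thesis .
qed

text \<open>The base is written as \<open>s^2\<close>, so that the usual power p^(i(i-1)/2) becomes
  \<open>s ^ (i * (i - 1))\<close> without halving; the triple product later needs odd powers of
  \<open>s\<close> too.\<close>

lemma q_binomial_theorem:
  assumes "norm s < 1"
  shows "(\<Prod>k<n. 1 + x * s ^ (2 * k)) = (\<Sum>i\<le>n. qbin (s\<^sup>2) n i * s ^ (i * (i - 1)) * x ^ i)"
proof (induction n)
  case 0
  then show ?case
    by (simp add: qbin_def qfact_def)
next
  case (Suc n)
  have p: "norm (s\<^sup>2) < 1"
    using assms by (simp add: norm_power power_less_one_iff)
  let ?a = "\<lambda>n i. qbin (s\<^sup>2) n i * s ^ (i * (i - 1)) * x ^ i"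
  have a0: "?a m 0 = 1" for m
    using qfact_nonzero[OF p] by (simp add: qbin_def qfact_def)
  have step: "?a (Suc n) (Suc i) = ?a n (Suc i) + x * s ^ (2 * n) * ?a n i" if "i \<le> n" for i
  proof -
    have "Suc i * (Suc i - 1) = 2 * i + i * (i - 1)"
      by (cases i) auto
    then have "s ^ (Suc i * (Suc i - 1)) = s ^ (2 * i) * s ^ (i * (i - 1))"
      by (simp only: power_add)
    moreover have "s ^ (2 * n) = (s\<^sup>2) ^ (n - i) * s ^ (2 * i)"
      using that by (metis add_mult_distrib2 le_add_diff_inverse2 power_add power_mult)
    ultimately show ?thesis
      unfolding qbin_Suc_Suc[OF p that] by (simp only: power_Suc ring_distribs mult_ac)
  qed
  have "(\<Sum>i\<le>Suc n. ?a (Suc n) i) = ?a (Suc n) 0 + (\<Sum>i\<le>n. ?a (Suc n) (Suc i))"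
    by (rule sum.atMost_Suc_shift)
  also have "\<dots> = ?a n 0 + (\<Sum>i\<le>n. ?a n (Suc i) + x * s ^ (2 * n) * ?a n i)"
    using a0 step by (simp del: power_Suc)
  also have "\<dots> = (\<Sum>i\<le>Suc n. ?a n i) + x * s ^ (2 * n) * (\<Sum>i\<le>n. ?a n i)"
    unfolding sum.atMost_Suc_shift[of _ n] sum.distrib sum_distrib_left[symmetric] by simp
  \<comment> \<open>The added top term vanishes, since \<open>qbin\<close> is 0 above the
    diagonal.\<close>
  also have "(\<Sum>i\<le>Suc n. ?a n i) = (\<Sum>i\<le>n. ?a n i)"
    by (simp add: qbin_def)
  finally show ?case
    using Suc.IH by (simp add: algebra_simps)
qed

section \<open>The Jacobi triple product\<close>

text \<open>Cauchy's derivation: the q-binomial theorem with 2n factors is recentred. The upper n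
  factors form one half of the product; the lower n factors become the other half by 1 + w = w (1 +
  1/w).\<close>

lemma finite_jacobi_triple_product:
  assumes s: "norm s < 1" "s \<noteq> 0" and y: "y \<noteq> 0"
  shows "(\<Prod>k<n. (1 + y * s ^ (2 * k + 1)) * (1 + s ^ (2 * k + 1) / y)) =
    (\<Sum>j\<in>{- int n..int n}. qbin (s\<^sup>2) (2 * n) (nat (int n + j)) * (s powi (j * j) * y powi j))"
proof -
  \<comment> \<open>With this shift the exponents of \<open>s\<close> in the 2n factors run through
    the odd numbers from 1 - 2n to 2n - 1.\<close>
  define x where "x = y * s powi (1 - 2 * int n)"
  have xs: "x * s ^ m = y * s powi (1 - 2 * int n + int m)" for m
    using s by (simp add: x_def power_int_add mult.assoc)
  have "{..<2 * n} = {..<n} \<union> {n..<2 * n}"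
    by auto
  then have "(\<Prod>k<2 * n. 1 + x * s ^ (2 * k)) =
      (\<Prod>k<n. 1 + x * s ^ (2 * k)) * (\<Prod>k\<in>{n..<2 * n}. 1 + x * s ^ (2 * k))"
    by (simp add: prod.union_disjoint ivl_disj_int)
  also have "(\<Prod>k\<in>{n..<2 * n}. 1 + x * s ^ (2 * k)) = (\<Prod>k<n. 1 + y * s ^ (2 * k + 1))"
  proof (rule prod.reindex_bij_witness[of _ "\<lambda>k. k + n" "\<lambda>k. k - n"])
    fix k assume k: "k \<in> {n..<2 * n}"
    then have "1 - 2 * int n + int (2 * k) = int (2 * (k - n) + 1)"
      by auto
    then show "1 + y * s ^ (2 * (k - n) + 1) = 1 + x * s ^ (2 * k)"
      unfolding xs by (simp only: power_int_of_nat)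
  qed auto
  also have "(\<Prod>k<n. 1 + x * s ^ (2 * k)) = (\<Prod>k<n. 1 + x * s ^ (2 * (n - Suc k)))"
    by (rule prod.nat_diff_reindex[symmetric])
  also have "\<dots> = (\<Prod>k<n. y * inverse (s ^ (2 * k + 1)) * (1 + s ^ (2 * k + 1) / y))"
  proof (rule prod.cong)
    fix k assume k: "k \<in> {..<n}"
    then have "1 - 2 * int n + int (2 * (n - Suc k)) = - int (2 * k + 1)"
      by auto
    then have "x * s ^ (2 * (n - Suc k)) = y * inverse (s ^ (2 * k + 1))"
      unfolding xs by (simp only: power_int_minus power_int_of_nat)
    then show "1 + x * s ^ (2 * (n - Suc k)) = y * inverse (s ^ (2 * k + 1)) * (1 + s ^ (2 * k + 1) / y)"
      using s y by (simp add: field_simps)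
  qed auto
  also have "\<dots> = y ^ n * inverse (s ^ (n * n)) * (\<Prod>k<n. 1 + s ^ (2 * k + 1) / y)"
  proof -
    have "(\<Prod>k<n. s ^ (2 * k + 1)) = s ^ (n * n)"
    proof (induction n)
      case (Suc n)
      have "Suc n * Suc n = n * n + (2 * n + 1)"
        by simp
      then show ?case
        by (simp only: prod.lessThan_Suc Suc.IH power_add[of s "n * n" "2 * n + 1"])
    qed simp
    then have "(\<Prod>k<n. inverse (s ^ (2 * k + 1))) = inverse (s ^ (n * n))"
      using prod_inversef[of "\<lambda>k. s ^ (2 * k + 1)" "{..<n}"] by (simp only: o_def)
    then show ?thesis
      by (simp only: prod.distrib prod_constant card_lessThan)
  qed
  finally have eq: "(\<Prod>k<2 * n. 1 + x * s ^ (2 * k)) = y ^ n * inverse (s ^ (n * n)) *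
      (\<Prod>k<n. 1 + s ^ (2 * k + 1) / y) * (\<Prod>k<n. 1 + y * s ^ (2 * k + 1))" .
  have "a * b = inverse (y ^ n) * s ^ (n * n) * (y ^ n * inverse (s ^ (n * n)) * b * a)" for a b
    using s y by (simp add: field_simps)
  then have "(\<Prod>k<n. (1 + y * s ^ (2 * k + 1)) * (1 + s ^ (2 * k + 1) / y)) =
      inverse (y ^ n) * s ^ (n * n) * (\<Prod>k<2 * n. 1 + x * s ^ (2 * k))"
    unfolding eq prod.distrib .
  also have "\<dots> = (\<Sum>i\<le>2 * n. inverse (y ^ n) * s ^ (n * n) * (qbin (s\<^sup>2) (2 * n) i * s ^ (i * (i - 1)) * x ^ i))"
    unfolding q_binomial_theorem[OF s(1)] sum_distrib_left ..
  also have "\<dots> = (\<Sum>j\<in>{- int n..int n}. qbin (s\<^sup>2) (2 * n) (nat (int n + j)) * (s powi (j * j) * y powi j))"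
  \<comment> \<open>The substitution i = n + j completes the square: n^2 + i (i - 1) + (1 - 2n) i =
    (i - n)^2.\<close>
  proof (rule sum.reindex_bij_witness[of _ "\<lambda>j. nat (int n + j)" "\<lambda>i. int i - int n"])
    fix i assume "i \<in> {..2 * n}"
    let ?j = "int i - int n"
    have "int (i * (i - 1)) = int i * (int i - 1)"
      by (cases i) (auto simp: algebra_simps)
    then have "s ^ (i * (i - 1)) = s powi (int i * (int i - 1))"
      by (metis power_int_of_nat)
    moreover have "s ^ (n * n) = s powi (int n * int n)"
      by (metis of_nat_mult power_int_of_nat)
    moreover have "(s powi (1 - 2 * int n)) ^ i = s powi ((1 - 2 * int n) * int i)"
      by (simp add: power_int_mult)
    ultimately have "s ^ (n * n) * (s ^ (i * (i - 1)) * (s powi (1 - 2 * int n)) ^ i) =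
       s powi (int n * int n + (int i * (int i - 1) + (1 - 2 * int n) * int i))"
      using s by (simp only: power_int_add simp_thms)
    also have "int n * int n + (int i * (int i - 1) + (1 - 2 * int n) * int i) = ?j * ?j"
      by (simp add: algebra_simps)
    finally have 1: "s ^ (n * n) * (s ^ (i * (i - 1)) * (s powi (1 - 2 * int n)) ^ i) = s powi (?j * ?j)" .
    have 2: "inverse (y ^ n) * y ^ i = y powi ?j"
      using y by (simp add: power_int_diff field_simps)
    have "inverse (y ^ n) * s ^ (n * n) * (qbin (s\<^sup>2) (2 * n) i * s ^ (i * (i - 1)) * x ^ i) =
      qbin (s\<^sup>2) (2 * n) i * ((s ^ (n * n) * (s ^ (i * (i - 1)) * (s powi (1 - 2 * int n)) ^ i)) * (inverse (y ^ n) * y ^ i))"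
      by (simp add: x_def power_mult_distrib mult_ac)
    moreover have "nat (int n + ?j) = i"
      by simp
    ultimately show "qbin (s\<^sup>2) (2 * n) (nat (int n + ?j)) * (s powi (?j * ?j) * y powi ?j) =
       inverse (y ^ n) * s ^ (n * n) * (qbin (s\<^sup>2) (2 * n) i * s ^ (i * (i - 1)) * x ^ i)"
      unfolding 1 2 by (simp only:)
  qed auto
  finally show ?thesis .
qed

text \<open>The n-th term is (t^n y)^n, and t^n y tends to 0, so the terms are eventually dominated
  by (1/2)^n.\<close>

lemma summable_norm_theta_series_nat:
  fixes t y :: complex
  assumes "norm t < 1"
  shows "summable (\<lambda>n. norm (t ^ (n * n) * y ^ n))"
proof (rule summable_comparison_test_ev)
  have "(\<lambda>n. norm (t ^ n * y)) \<longlonglongrightarrow> norm (0 * y)"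
    by (intro tendsto_intros LIMSEQ_power_zero assms)
  then have "\<forall>\<^sub>F n in sequentially. norm (t ^ n * y) < 1 / 2"
    by (rule order_tendstoD) simp
  then show "\<forall>\<^sub>F n in sequentially. norm (norm (t ^ (n * n) * y ^ n)) \<le> (1 / 2) ^ n"
  proof eventually_elim
    case (elim n)
    have "norm (t ^ (n * n) * y ^ n) = norm (t ^ n * y) ^ n"
      by (simp add: norm_mult norm_power power_mult power_mult_distrib)
    with elim show ?case
      by (simp add: power_mono)
  qed
qed (simp add: summable_geometric)

lemma theta_series_abs_summable:
  fixes t y :: complex
  assumes "norm t < 1"
  shows "(\<lambda>s::int. norm (t powi (s * s) * y powi s)) summable_on UNIV"
proof -
  let ?f = "\<lambda>s::int. norm (t powi (s * s) * y powi s)"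
  \<comment> \<open>The negative half is the series of the previous lemma with
    \<open>inverse y\<close>; counting 0 in both halves does not affect summability.\<close>
  have U: "(UNIV :: int set) = range int \<union> range (\<lambda>n. - int n)"
    using int_cases2 by blast
  have "?f \<circ> int = (\<lambda>n. norm (t ^ (n * n) * y ^ n))"
    by (simp add: fun_eq_iff flip: of_nat_mult)
  then have "(?f \<circ> int) summable_on UNIV"
    using summable_norm_theta_series_nat[OF assms, of y] by (simp add: summable_on_UNIV_nonneg_real_iff)
  then have 1: "?f summable_on range int"
    by (subst summable_on_reindex) (auto simp: inj_on_def)
  have "?f \<circ> (\<lambda>n. - int n) = (\<lambda>n. norm (t ^ (n * n) * inverse y ^ n))"
    by (simp add: fun_eq_iff power_int_minus power_inverse flip: of_nat_mult)
  then have "(?f \<circ> (\<lambda>n. - int n)) summable_on UNIV"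
    using summable_norm_theta_series_nat[OF assms, of "inverse y"] by (simp add: summable_on_UNIV_nonneg_real_iff)
  then have 2: "?f summable_on range (\<lambda>n. - int n)"
    by (subst summable_on_reindex) (auto simp: inj_on_def)
  show ?thesis
    unfolding U using 1 2 by (rule summable_on_union)
qed

definition theta_series :: "complex \<Rightarrow> complex \<Rightarrow> complex" where
  "theta_series t y = (\<Sum>\<^sub>\<infinity>s::int. t powi (s * s) * y powi s)"

lemma has_sum_theta_series:
  assumes "norm t < 1"
  shows "((\<lambda>s::int. t powi (s * s) * y powi s) has_sum theta_series t y) UNIV"
  unfolding theta_series_def
  by (rule has_sum_infsum[OF abs_summable_summable[OF theta_series_abs_summable[OF assms]]])

text \<open>The finite form tends to this as n grows: each Gaussian binomial coefficient tends to 1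
  / \<open>qpoch p p\<close>, and Tannery's theorem permits the limit inside the sum.\<close>

theorem jacobi_triple_product:
  assumes s: "norm s < 1" "s \<noteq> 0" and y: "y \<noteq> 0"
  shows "theta_series s y = qpoch (s\<^sup>2) (s\<^sup>2) * qpoch (- y * s) (s\<^sup>2) * qpoch (- s / y) (s\<^sup>2)"
proof -
  define p where "p = s\<^sup>2"
  have p: "norm p < 1"
    using s by (simp add: p_def norm_power power_less_one_iff)
  define L where "L = qpoch p p"
  have L0: "L \<noteq> 0"
    unfolding L_def by (rule qpoch_nonzero) (use p in auto)
  have lim: "qfact p \<longlonglongrightarrow> L"
    unfolding L_def by (rule qfact_LIMSEQ[OF p])
  \<comment> \<open>Bounds on \<open>qfact\<close> and on its reciprocal bound all Gaussian binomial
    coefficients at once, which supplies the dominating series.\<close>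
  obtain M where M: "\<And>n. norm (qfact p n) \<le> M"
    using convergent_imp_Bseq[OF convergentI[OF lim]] by (auto simp: Bseq_def)
  obtain m where m: "\<And>n. norm (inverse (qfact p n)) \<le> m"
    using convergent_imp_Bseq[OF convergentI[OF tendsto_inverse[OF lim L0]]] by (auto simp: Bseq_def)
  have M0: "0 \<le> M" and m0: "0 \<le> m"
    using order_trans[OF norm_ge_zero M[of 0]] order_trans[OF norm_ge_zero m[of 0]] .
  define g where "g j = s powi (j * j) * y powi j" for j
  \<comment> \<open>The integers are enumerated by \<open>int_decode\<close>, because Tannery's
    theorem is applied to a series over the naturals; terms outside the finite range are set to
    0.\<close>
  define a where "a k n = (let j = int_decode k in
      if j \<in> {- int n..int n} then qbin p (2 * n) (nat (int n + j)) * g j else 0)" for k n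
  have abs_g: "(\<lambda>j. norm (g j)) summable_on UNIV"
    unfolding g_def by (rule theta_series_abs_summable[OF s(1)])
  have sum_g: "summable (\<lambda>k. norm (g (int_decode k)))"
  proof -
    have "(\<lambda>k. norm (g (int_decode k))) summable_on UNIV"
      using abs_g by (subst summable_on_reindex_bij_betw[of int_decode UNIV UNIV "\<lambda>j. norm (g j)"])
        (simp_all add: bij_int_decode)
    then show ?thesis
      by (simp add: summable_on_UNIV_nonneg_real_iff)
  qed
  have bound: "norm (a k n) \<le> M * m * m * norm (g (int_decode k))" for k n
  proof -
    have "norm (qbin p N i) \<le> M * m * m" for N i
    proof -
      have "norm (qfact p N * inverse (qfact p i) * inverse (qfact p (N - i))) \<le> M * m * m"
        unfolding norm_mult by (intro mult_mono M m mult_nonneg_nonneg norm_ge_zero M0 m0)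
      then show ?thesis
        using M0 m0 by (simp add: qbin_def divide_inverse mult_ac)
    qed
    then show ?thesis
      using M0 m0 by (auto simp: a_def Let_def norm_mult intro: mult_right_mono)
  qed
  have limit: "a k \<longlonglongrightarrow> inverse L * g (int_decode k)" for k
  proof -
    define j where "j = int_decode k"
    \<comment> \<open>For fixed \<open>j\<close> both n + j and n - j tend to infinity, so all three
      q-factorials tend to \<open>L\<close>.\<close>
    have top: "filterlim (\<lambda>n. nat (int n + i)) at_top sequentially" for i
      unfolding filterlim_at_top
    proof
      fix Z
      show "\<forall>\<^sub>F n in sequentially. Z \<le> nat (int n + i)"
        using eventually_ge_at_top[of "Z + nat (- i)"] by eventually_elim auto
    qed
    have "(\<lambda>n. qfact p (2 * n) / (qfact p (nat (int n + j)) * qfact p (nat (int n + - j))) * g j)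
        \<longlonglongrightarrow> L / (L * L) * g j"
    proof (intro tendsto_intros)
      show "(\<lambda>n. qfact p (2 * n)) \<longlonglongrightarrow> L"
        by (rule filterlim_compose[OF lim]) (rule filterlim_subseq, simp add: strict_mono_def)
    qed (use L0 in \<open>auto intro!: filterlim_compose[OF lim] top simp del: add_uminus_conv_diff\<close>)
    moreover have "\<forall>\<^sub>F n in sequentially. a k n =
        qfact p (2 * n) / (qfact p (nat (int n + j)) * qfact p (nat (int n + - j))) * g j"
      using eventually_ge_at_top[of "nat \<bar>j\<bar>"]
    proof eventually_elim
      case (elim n)
      then have "nat (int n + j) \<le> 2 * n" "2 * n - nat (int n + j) = nat (int n + - j)"
        "j \<in> {- int n..int n}"
        by auto
      with elim show ?case
        by (simp add: a_def Let_def qbin_def flip: j_def)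
    qed
    moreover have "L / (L * L) = inverse L"
      using L0 by (simp add: field_simps)
    ultimately show ?thesis
      by (simp add: tendsto_cong j_def)
  qed
  have "(\<lambda>n. \<Sum>k. a k n) \<longlonglongrightarrow> (\<Sum>k. inverse L * g (int_decode k))"
  proof -
    have "\<forall>\<^sub>F (k, n) in at_top \<times>\<^sub>F sequentially. norm (a k n) \<le> M * m * m * norm (g (int_decode k))"
      by (rule always_eventually) (use bound in auto)
    from tannerys_theorem[of a "\<lambda>k. inverse L * g (int_decode k)", OF limit this summable_mult[OF sum_g]]
    show ?thesis by simp
  qed
  moreover have "(\<Sum>k. inverse L * g (int_decode k)) = inverse L * theta_series s y"
  proof -
    have "(g has_sum theta_series s y) UNIV"
      unfolding g_def by (rule has_sum_theta_series[OF s(1)])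
    then have "((\<lambda>k. g (int_decode k)) has_sum theta_series s y) UNIV"
      by (subst has_sum_reindex_bij_betw) (auto simp: bij_int_decode)
    then show ?thesis
      by (intro sums_unique[symmetric] sums_mult has_sum_imp_sums)
  qed
  moreover have "(\<Sum>k. a k n) = (\<Prod>k<n. 1 - (- y * s) * p ^ k) * (\<Prod>k<n. 1 - (- s / y) * p ^ k)" for n
  proof -
    let ?h = "\<lambda>j. if j \<in> {- int n..int n} then qbin p (2 * n) (nat (int n + j)) * g j else 0"
    have "(?h has_sum (\<Sum>j\<in>{- int n..int n}. ?h j)) UNIV"
      by (rule has_sum_finite_neutralI[of "{- int n..int n}"]) auto
    then have "((\<lambda>k. ?h (int_decode k)) has_sum (\<Sum>j\<in>{- int n..int n}. ?h j)) UNIV"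
      by (subst has_sum_reindex_bij_betw[of int_decode UNIV UNIV ?h]) (auto simp: bij_int_decode)
    then have "(\<Sum>k. a k n) = (\<Sum>j\<in>{- int n..int n}. ?h j)"
      unfolding a_def Let_def by (intro sums_unique[symmetric] has_sum_imp_sums)
    also have "\<dots> = (\<Prod>k<n. (1 + y * s ^ (2 * k + 1)) * (1 + s ^ (2 * k + 1) / y))"
      unfolding finite_jacobi_triple_product[OF s y] by (simp add: g_def p_def)
    finally show ?thesis
      by (simp add: prod.distrib p_def mult_ac flip: power_mult)
  qed
  moreover have "(\<lambda>n. (\<Prod>k<n. 1 - (- y * s) * p ^ k) * (\<Prod>k<n. 1 - (- s / y) * p ^ k))
      \<longlonglongrightarrow> qpoch (- y * s) p * qpoch (- s / y) p"
    by (intro tendsto_mult qpoch_LIMSEQ p)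
  ultimately have "inverse L * theta_series s y = qpoch (- y * s) p * qpoch (- s / y) p"
    by (metis (no_types, lifting) LIMSEQ_unique ext)
  then show ?thesis
    using L0 by (simp add: L_def p_def field_simps)
qed

section \<open>The Weierstrass three-term relation\<close>

text \<open>The argument \<open>- z / t^2\<close> is chosen so that the triple product with
  \<open>s = t^2\<close> has the product arguments z and t^4 / z.\<close>

lemma theta_series_eq_theta:
  assumes t: "norm t < 1" "t \<noteq> 0" and z: "z \<noteq> 0"
  shows "theta_series (t\<^sup>2) (- z / t\<^sup>2) = qpoch (t ^ 4) (t ^ 4) * theta z (t ^ 4)"
proof -
  have "norm (t\<^sup>2) < 1"
    using t by (simp add: norm_power power_less_one_iff)
  moreover have "(t\<^sup>2)\<^sup>2 = t ^ 4" "- (t\<^sup>2) / (- z / t\<^sup>2) = t ^ 4 / z"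
    by (simp_all flip: power_mult power_add)
  ultimately show ?thesis
    using jacobi_triple_product[of "t\<^sup>2" "- z / t\<^sup>2"] t z by (simp add: theta_def mult_ac)
qed

lemma has_sum_theta_series_mult:
  assumes "norm t < 1"
  shows "((\<lambda>(r, s). (t powi (r * r) * x powi r) * (t powi (s * s) * y powi s))
      has_sum theta_series t x * theta_series t y) (UNIV \<times> UNIV)"
proof (rule has_sum_SigmaI)
  let ?f = "\<lambda>x (r::int). t powi (r * r) * x powi r"
  show "((\<lambda>s. case (r, s) of (r, s) \<Rightarrow> ?f x r * ?f y s) has_sum ?f x r * theta_series t y) UNIV" for r
    using has_sum_cmult_right[OF has_sum_theta_series[OF assms]] by simp
  show "((\<lambda>r. ?f x r * theta_series t y) has_sum theta_series t x * theta_series t y) UNIV"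
    by (rule has_sum_cmult_left[OF has_sum_theta_series[OF assms]])
  have "(\<lambda>rs. norm (case rs of (r, s) \<Rightarrow> ?f x r * ?f y s)) summable_on UNIV \<times> UNIV"
  proof (rule summable_on_SigmaI)
    show "((\<lambda>s. norm (case (r, s) of (r, s) \<Rightarrow> ?f x r * ?f y s)) has_sum
        norm (?f x r) * infsum (\<lambda>s. norm (?f y s)) UNIV) UNIV" for r
      using has_sum_cmult_right[OF has_sum_infsum[OF theta_series_abs_summable[OF assms]]]
      by (simp add: norm_mult)
    show "(\<lambda>r. norm (?f x r) * infsum (\<lambda>s. norm (?f y s)) UNIV) summable_on UNIV"
      by (rule summable_on_cmult_left[OF theta_series_abs_summable[OF assms]])
  qed auto
  then show "(\<lambda>(r, s). ?f x r * ?f y s) summable_on UNIV \<times> UNIV"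
    by (rule abs_summable_summable)
qed

text \<open>The combined coefficient of t^(r^2+s^2) x^r y^s is (-1)^s - (-1)^r, which is 0 unless r
  + s is odd. On the odd sublattice a rotation by 45 degrees diagonalises r^2 + s^2, and the double
  sum factors.\<close>

lemma theta_series_determinant:
  assumes t: "norm t < 1" "t \<noteq> 0" and xy: "x \<noteq> 0" "y \<noteq> 0"
  shows "theta_series t x * theta_series t (- y) - theta_series t (- x) * theta_series t y =
    2 * t / x * theta_series (t\<^sup>2) (- (x * y) / t\<^sup>2) * theta_series (t\<^sup>2) (- (x / y) / t\<^sup>2)"
proof -
  let ?a = "\<lambda>(r, s). (t powi (r * r) * x powi r) * (t powi (s * s) * (- y) powi s)"
  let ?b = "\<lambda>(r, s). (t powi (r * r) * (- x) powi r) * (t powi (s * s) * y powi s)"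
  let ?c = "\<lambda>(m, n). ((t\<^sup>2) powi (m * m) * (- (x * y) / t\<^sup>2) powi m) *
      ((t\<^sup>2) powi (n * n) * (- (x / y) / t\<^sup>2) powi n)"
  have t2: "norm (t\<^sup>2) < 1"
    using t by (simp add: norm_power power_less_one_iff)
  have "((\<lambda>rs. ?a rs - ?b rs) has_sum
      (theta_series t x * theta_series t (- y) - theta_series t (- x) * theta_series t y)) (UNIV \<times> UNIV)"
    using has_sum_theta_series_mult[OF t(1), of x "- y"] has_sum_theta_series_mult[OF t(1), of "- x" y]
    by (rule has_sum_add[OF _ has_sum_uminusI, simplified])
  also have "?this \<longleftrightarrow> ((\<lambda>rs. ?a rs - ?b rs) has_sum
      (theta_series t x * theta_series t (- y) - theta_series t (- x) * theta_series t y)) {(r, s). odd (r + s)}"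
    by (rule has_sum_cong_neutral) (auto simp: power_int_minus_left split: if_splits)
  also have "\<dots> \<longleftrightarrow> ((\<lambda>mn. 2 * t / x * ?c mn) has_sum
      (theta_series t x * theta_series t (- y) - theta_series t (- x) * theta_series t y)) (UNIV \<times> UNIV)"
  \<comment> \<open>With r = m + n - 1 and s = m - n one has r^2 + s^2 = (2m^2 - 2m) + (2n^2 - 2n) +
    1; the last summand is the factor \<open>t\<close> in front.\<close>
  proof (rule has_sum_reindex_bij_witness[of _ "\<lambda>(r, s). ((r + s + 1) div 2, (r - s + 1) div 2)"
        "\<lambda>(m, n). (m + n - 1, m - n)", symmetric], goal_cases)
    case (5 mn)
    obtain m n where mn: "mn = (m, n)"
      by fastforce
    have 1: "(t powi ((m + n - 1) * (m + n - 1)) * u powi (m + n - 1)) * (t powi ((m - n) * (m - n)) * v powi (m - n)) =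
        t powi (2 * (m * m) - 2 * m) * t powi (2 * (n * n) - 2 * n) * t * (u powi m * u powi n / u) * (v powi m / v powi n)"
      if "u \<noteq> 0" "v \<noteq> 0" for u v
    proof -
      have "(m + n - 1) * (m + n - 1) + (m - n) * (m - n) = (2 * (m * m) - 2 * m) + (2 * (n * n) - 2 * n) + 1"
        by (simp add: algebra_simps)
      then have "t powi ((m + n - 1) * (m + n - 1)) * t powi ((m - n) * (m - n)) =
          t powi (2 * (m * m) - 2 * m) * t powi (2 * (n * n) - 2 * n) * t"
        using t by (metis power_int_add power_int_1_right)
      then show ?thesis
        using that by (simp add: power_int_diff power_int_add)
    qed
    have 2: "(t\<^sup>2) powi (k * k) * (- w / t\<^sup>2) powi k = (- 1) powi k * t powi (2 * (k * k) - 2 * k) * w powi k" for k w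
      using t by (simp add: power_int_diff power_int_divide_distrib power_int_mult power_int_minus_left)
    show ?case
      unfolding mn prod.case 2 using t xy 1[of x "- y"] 1[of "- x" y]
      by (auto simp: power_int_minus_left power_int_mult_distrib power_int_divide_distrib field_simps)
  qed (auto, presburger+)
  finally have "((\<lambda>mn. 2 * t / x * ?c mn) has_sum
      (theta_series t x * theta_series t (- y) - theta_series t (- x) * theta_series t y)) (UNIV \<times> UNIV)" .
  moreover have "((\<lambda>mn. 2 * t / x * ?c mn) has_sum
      2 * t / x * (theta_series (t\<^sup>2) (- (x * y) / t\<^sup>2) * theta_series (t\<^sup>2) (- (x / y) / t\<^sup>2))) (UNIV \<times> UNIV)"
    by (intro has_sum_cmult_right has_sum_theta_series_mult[OF t2])
  ultimately show ?thesis
    using has_sum_unique by (fastforce simp: mult.assoc)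
qed

text \<open>Up to a factor depending only on \<open>t\<close>, the product \<open>\<theta>(xy) \<theta>(x/y)\<close> is \<open>x\<close> times a two-by-two
  determinant \<open>D x y\<close> of theta series, so the three-term relation is the Pluecker relation for \<open>D\<close>.\<close>

theorem weierstrass_three_term:
  assumes t: "norm t < 1" "t \<noteq> 0" and nz: "x \<noteq> 0" "y \<noteq> 0" "u \<noteq> 0" "v \<noteq> 0"
  defines "\<theta> \<equiv> \<lambda>z. theta z (t ^ 4)"
  shows "\<theta> (x * y) * \<theta> (x / y) * \<theta> (u * v) * \<theta> (u / v) - \<theta> (x * v) * \<theta> (x / v) * \<theta> (u * y) * \<theta> (u / y) =
    u / y * (\<theta> (y * v) * \<theta> (y / v) * \<theta> (x * u) * \<theta> (x / u))"
proof -
  define D where "D x y = theta_series t x * theta_series t (- y) - theta_series t (- x) * theta_series t y" for x y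
  define c where "c = 2 * t * qpoch (t ^ 4) (t ^ 4) ^ 2"
  have "qpoch (t ^ 4) (t ^ 4) \<noteq> 0"
    using t by (intro qpoch_nonzero) (simp_all add: norm_power power_less_one_iff)
  then have c: "c \<noteq> 0"
    using t by (simp add: c_def)
  have D: "\<theta> (a * b) * \<theta> (a / b) = a * D a b / c" if "a \<noteq> 0" "b \<noteq> 0" for a b
  proof -
    have "D a b = c / a * (\<theta> (a * b) * \<theta> (a / b))"
      using that theta_series_eq_theta[OF t, of "a * b"] theta_series_eq_theta[OF t, of "a / b"]
      unfolding D_def theta_series_determinant[OF t that] c_def \<theta>_def
      by (simp only: power2_eq_square) (simp add: divide_inverse mult_ac)
    then show ?thesis
      using c that by simp
  qed
  have "\<theta> (x * y) * \<theta> (x / y) * (\<theta> (u * v) * \<theta> (u / v)) - \<theta> (x * v) * \<theta> (x / v) * (\<theta> (u * y) * \<theta> (u / y)) =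
     x * u / c ^ 2 * (D x y * D u v - D x v * D u y)"
    unfolding D[OF nz(1,2)] D[OF nz(3,4)] D[OF nz(1,4)] D[OF nz(3,2)]
    using c by (simp add: power2_eq_square field_simps)
  also have "D x y * D u v - D x v * D u y = D y v * D x u"
    unfolding D_def by (simp add: algebra_simps)
  also have "x * u / c ^ 2 * (D y v * D x u) = u / y * ((\<theta> (y * v) * \<theta> (y / v)) * (\<theta> (x * u) * \<theta> (x / u)))"
    unfolding D[OF nz(2,4)] D[OF nz(1,3)] using nz c by (simp add: power2_eq_square)
  finally show ?thesis
    by (simp only: mult.assoc)
qed

section \<open>Generating functions of partitions\<close>

lemma member_le_sum_mset:
  fixes P :: "nat multiset"
  assumes "k \<in># P"
  shows "k \<le> sum_mset P"
  using multi_member_split[OF assms] by auto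

text \<open>All parts are positive, so the largest part and the number of parts are both at most
  \<open>n\<close>.\<close>

lemma finite_partitions:
  assumes "0 \<notin> S"
  shows "finite {P :: nat multiset. set_mset P \<subseteq> S \<and> sum_mset P = n}"
proof (rule finite_subset)
  have size: "size P \<le> sum_mset P" if "0 \<notin># P" for P :: "nat multiset"
    using that by (induction P) auto
  show "{P. set_mset P \<subseteq> S \<and> sum_mset P = n} \<subseteq> mset ` {xs. set xs \<subseteq> {..n} \<and> length xs \<le> n}"
  proof
    fix P assume P: "P \<in> {P. set_mset P \<subseteq> S \<and> sum_mset P = n}"
    obtain xs where xs: "P = mset xs"
      using ex_mset by metis
    have "set xs \<subseteq> {..n}"
      using P member_le_sum_mset[of _ P] by (auto simp: xs)
    moreover have "length xs \<le> n"
      using P size[of P] assms by (auto simp: xs)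
    ultimately show "P \<in> mset ` {xs. set xs \<subseteq> {..n} \<and> length xs \<le> n}"
      using xs by blast
  qed
qed (simp add: finite_lists_length_le)

text \<open>Partitions are sorted by whether \<open>k\<close> occurs; removing one copy of
  \<open>k\<close> is a bijection in the second case. The guard \<open>k \<le> n\<close> keeps the
  truncated difference from counting anything when n < k.\<close>

lemma partition_count_insert:
  assumes "0 \<notin> S" "k > 0" "k \<notin> S"
  shows "partition_count (insert k S) n =
    partition_count S n + (if k \<le> n then partition_count (insert k S) (n - k) else 0)"
proof -
  let ?A = "\<lambda>S n. {P :: nat multiset. set_mset P \<subseteq> S \<and> sum_mset P = n}"
  define B where "B = {P \<in> ?A (insert k S) n. k \<in># P}"
  have fin: "finite (?A (insert k S) m)" for m
    using assms by (intro finite_partitions) auto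
  have U: "?A (insert k S) n = ?A S n \<union> B" "?A S n \<inter> B = {}"
    using assms by (auto simp: B_def)
  have "finite (?A S n \<union> B)"
    using fin[of n] by (simp only: U(1))
  then have "card (?A (insert k S) n) = card (?A S n) + card B"
    unfolding U(1) using U(2) by (intro card_Un_disjoint) auto
  moreover have "card B = (if k \<le> n then card (?A (insert k S) (n - k)) else 0)"
  proof (cases "k \<le> n")
    case True
    have "bij_betw (add_mset k) (?A (insert k S) (n - k)) B"
      unfolding B_def by (rule bij_betwI[where g = "\<lambda>P. P - {#k#}"])
         (use True in \<open>auto dest: in_diffD simp: sum_mset_diff\<close>)
    then show ?thesis
      using True by (simp add: bij_betw_same_card)
  next
    case False
    then have "B = {}"
      by (auto simp: B_def dest!: multi_member_split)
    then show ?thesis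
      using False by (simp only: card.empty if_False)
  qed
  ultimately show ?thesis
    by (simp add: partition_count_def)
qed

lemma partition_count_mono:
  assumes "S \<subseteq> T" "0 \<notin> T"
  shows "partition_count S n \<le> partition_count T n"
  unfolding partition_count_def using assms by (intro card_mono finite_partitions) auto

lemma partition_count_restrict:
  assumes "n < N"
  shows "partition_count (S \<inter> {..<N}) n = partition_count S n"
proof -
  have "{P. set_mset P \<subseteq> S \<inter> {..<N} \<and> sum_mset P = n} = {P. set_mset P \<subseteq> S \<and> sum_mset P = n}"
    using assms by (auto dest: member_le_sum_mset)
  then show ?thesis
    by (simp add: partition_count_def)
qed

lemma partition_count_0:
  assumes "0 \<notin> S"
  shows "partition_count S 0 = 1"
proof -
  have "{P :: nat multiset. set_mset P \<subseteq> S \<and> sum_mset P = 0} = {{#}}"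
  proof (intro equalityI subsetI)
    fix P assume P: "P \<in> {P :: nat multiset. set_mset P \<subseteq> S \<and> sum_mset P = 0}"
    then have "k = 0" if "k \<in># P" for k
      using that by (auto dest: multi_member_split)
    with P assms have "set_mset P = {}"
      by blast
    then show "P \<in> {{#}}" by simp
  qed auto
  then show ?thesis
    by (simp add: partition_count_def)
qed

lemma partition_count_small:
  assumes "0 < n" "\<And>k. k \<in> S \<Longrightarrow> n < k"
  shows "partition_count S n = 0"
proof -
  have "S \<inter> {..<Suc n} = {}"
    using assms(2) by fastforce
  then have "partition_count S n = partition_count {} n"
    using partition_count_restrict[of n "Suc n" S] by simp
  also have "\<dots> = 0"
    using assms(1) by (auto simp: partition_count_def card_eq_0_iff)
  finally show ?thesis .
qed

section \<open>Euler products for partition counts\<close>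

text \<open>Inserting \<open>k\<close> turns the recursion into B = G + q^k B for the generating
  functions. Convergence of B must come first; nonnegativity reduces it to a bound on partial
  sums.\<close>

lemma sums_partition_count_finite:
  fixes q :: real
  assumes q: "0 < q" "q < 1" and "finite S" "0 \<notin> S"
  shows "(\<lambda>n. partition_count S n * q ^ n) sums (\<Prod>k\<in>S. inverse (1 - q ^ k))"
  using assms(3,4)
proof (induction S rule: finite_induct)
  case empty
  have "partition_count {} n = (if n = 0 then 1 else 0)" for n
    using partition_count_0[of "{}"] partition_count_small[of n "{}"] by auto
  then have "(\<lambda>n. partition_count {} n * q ^ n) = (\<lambda>n. if n = 0 then 1 else 0)"
    by (auto simp: fun_eq_iff)
  then show ?case
    using sums_single[of 0 "\<lambda>_. 1 :: real"] by simp
next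
  case (insert k S)
  then have k: "k > 0" "0 \<notin> S" "0 \<notin> insert k S"
    by auto
  let ?G = "\<Prod>k\<in>S. inverse (1 - q ^ k)"
  define a where "a n = partition_count S n * q ^ n" for n
  define b where "b n = partition_count (insert k S) n * q ^ n" for n
  have a: "a sums ?G"
    unfolding a_def using insert k by auto
  have qk: "q ^ k < 1"
    using q k by (simp add: power_less_one_iff)
  have b0: "b n \<ge> 0" for n
    using q by (simp add: b_def)
  have rec: "b n = a n + (if k \<le> n then q ^ k * b (n - k) else 0)" for n
  proof (cases "k \<le> n")
    case True
    then have "q ^ n = q ^ k * q ^ (n - k)"
      by (simp flip: power_add)
    with True show ?thesis
      unfolding a_def b_def partition_count_insert[OF k(2,1) insert.hyps(2), of n]
      by (simp add: distrib_right)
  qed (simp add: a_def b_def partition_count_insert[OF k(2,1) insert.hyps(2), of n])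
  \<comment> \<open>The recursion applied to a partial sum gives B_N \<le> G + q^k B_N, which is
    solved for B_N.\<close>
  have le: "(\<Sum>n<N. b n) \<le> ?G / (1 - q ^ k)" for N
  proof -
    have "(\<Sum>n<N. if k \<le> n then q ^ k * b (n - k) else 0) = (\<Sum>n\<in>{k..<N}. q ^ k * b (n - k))"
      by (rule sum.mono_neutral_cong_right) auto
    also have "\<dots> = (\<Sum>n<N - k. q ^ k * b n)"
      by (rule sum.reindex_bij_witness[of _ "\<lambda>n. n + k" "\<lambda>n. n - k"]) auto
    also have "\<dots> \<le> (\<Sum>n<N. q ^ k * b n)"
      using q b0 by (intro sum_mono2) auto
    finally have "(\<Sum>n<N. if k \<le> n then q ^ k * b (n - k) else 0) \<le> q ^ k * (\<Sum>n<N. b n)"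
      by (simp only: sum_distrib_left)
    moreover have "(\<Sum>n<N. b n) = (\<Sum>n<N. a n + (if k \<le> n then q ^ k * b (n - k) else 0))"
      by (rule sum.cong[OF refl rec])
    ultimately have "(\<Sum>n<N. b n) \<le> (\<Sum>n<N. a n) + q ^ k * (\<Sum>n<N. b n)"
      unfolding sum.distrib by linarith
    moreover have "(\<Sum>n<N. a n) \<le> ?G"
      using a q sum_le_suminf[of a "{..<N}"] by (auto simp: a_def sums_iff)
    ultimately show ?thesis
      using qk by (simp add: field_simps)
  qed
  have sb: "summable b"
    by (rule summableI_nonneg_bounded[OF b0 le])
  have "(\<lambda>n. if k \<le> n then q ^ k * b (n - k) else 0) sums (q ^ k * suminf b)"
    using sums_iff_shift[of "\<lambda>n. if k \<le> n then q ^ k * b (n - k) else 0" k "q ^ k * suminf b"]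
      sums_mult[OF summable_sums[OF sb], of "q ^ k"] by simp
  from sums_add[OF a this] have "b sums (?G + q ^ k * suminf b)"
    by (rule sums_cong[OF rec, THEN iffD2])
  then have "suminf b = ?G + q ^ k * suminf b"
    using sums_unique by force
  then have "suminf b = inverse (1 - q ^ k) * ?G"
    using qk by (simp add: field_simps)
  with sb have "b sums (inverse (1 - q ^ k) * ?G)"
    by (simp add: sums_iff)
  then show ?case
    using insert.hyps by (simp add: b_def[abs_def])
qed

text \<open>Two-sided estimate: partial sums only see parts below the cutoff and so are at most
  \<open>H N\<close>, hence at most 1 / L; conversely \<open>H N\<close> counts fewer partitions
  than the full series. The cutoffs are multiples of \<open>m\<close> to match complete blocks of
  residues.\<close>

lemma sums_partition_count:
  fixes q L :: real
  assumes q: "0 < q" "q < 1" and S: "0 \<notin> S" and m: "m > 0" and L: "L > 0"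
    and lim: "(\<lambda>N. \<Prod>k\<in>S \<inter> {..<N * m}. 1 - q ^ k) \<longlonglongrightarrow> L"
  shows "(\<lambda>n. partition_count S n * q ^ n) sums inverse L"
proof -
  define H where "H N = (\<Prod>k\<in>S \<inter> {..<N * m}. inverse (1 - q ^ k))" for N
  have H_lim: "H \<longlonglongrightarrow> inverse L"
    unfolding H_def using tendsto_inverse[OF lim] L by (simp add: prod_inversef[symmetric] o_def)
  have fac: "1 \<le> inverse (1 - q ^ k)" if "k \<in> S" for k
  proof -
    have "k > 0" using that S by (cases k) auto
    then have "0 < 1 - q ^ k" "1 - q ^ k \<le> 1"
      using q by (simp_all add: power_less_one_iff)
    then show ?thesis
      by (rule one_le_inverse)
  qed
  have "incseq H"
    unfolding H_def
  proof (intro incseq_SucI prod_mono2)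
    show "0 \<le> inverse (1 - q ^ k)" if "k \<in> S \<inter> {..<N * m}" for k N
      using order_trans[OF zero_le_one fac[of k]] that by blast
  qed (use fac in auto)
  then have H_le: "H N \<le> inverse L" for N
    using H_lim by (rule incseq_le)
  have sums_H: "(\<lambda>n. partition_count (S \<inter> {..<N * m}) n * q ^ n) sums H N" for N
    unfolding H_def using S by (intro sums_partition_count_finite q) auto
  have le: "(\<Sum>n<N. partition_count S n * q ^ n) \<le> inverse L" for N
  proof -
    have "(\<Sum>n<N. partition_count S n * q ^ n) = (\<Sum>n<N. partition_count (S \<inter> {..<N * m}) n * q ^ n)"
    proof (rule sum.cong)
      fix n assume "n \<in> {..<N}"
      then have "n < N * m"
        using m by (cases m) auto
      then show "partition_count S n * q ^ n = partition_count (S \<inter> {..<N * m}) n * q ^ n"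
        by (simp add: partition_count_restrict)
    qed auto
    also have "\<dots> \<le> H N"
      using sums_H[of N] q sum_le_suminf[of "\<lambda>n. partition_count (S \<inter> {..<N * m}) n * q ^ n" "{..<N}"]
      by (auto simp: sums_iff)
    also have "\<dots> \<le> inverse L"
      by (rule H_le)
    finally show ?thesis .
  qed
  have summ: "summable (\<lambda>n. partition_count S n * q ^ n)"
    using q le by (intro summableI_nonneg_bounded) auto
  have "(\<Sum>n. partition_count S n * q ^ n) \<le> inverse L"
    using summ le by (rule suminf_le_const)
  moreover have "inverse L \<le> (\<Sum>n. partition_count S n * q ^ n)"
  proof (rule LIMSEQ_le_const2[OF H_lim], intro exI allI impI)
    fix N
    show "H N \<le> (\<Sum>n. partition_count S n * q ^ n)"
      using q S by (intro sums_le[OF _ sums_H summable_sums[OF summ]] mult_right_mono)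
        (auto intro: partition_count_mono)
  qed
  ultimately show ?thesis
    using summ by (simp add: sums_iff)
qed

section \<open>Comparing coefficients of power series\<close>

text \<open>Zeros of a nonzero power series are isolated, whereas this one vanishes on all of (0,
  1).\<close>

lemma powser_zero_coeff:
  fixes h :: "nat \<Rightarrow> real"
  assumes "\<And>q. 0 < q \<Longrightarrow> q < 1 \<Longrightarrow> (\<lambda>n. h n * q ^ n) sums 0"
  shows "h n = 0"
proof (rule ccontr)
  assume n: "h n \<noteq> 0"
  \<comment> \<open>The series is multiplied by x, so that \<open>f\<close> vanishes at the centre
    and the nonzero coefficient has the positive index \<open>Suc n\<close>, as
    \<open>powser_0_nonzero\<close> asks.\<close>
  define a where "a n = (case n of 0 \<Rightarrow> 0 | Suc m \<Rightarrow> h m)" for n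
  define f where "f x = x * (\<Sum>n. h n * x ^ n)" for x :: real
  have sums: "(\<lambda>n. a n * (x - 0) ^ n) sums f x" if x: "norm (x - 0) < 1" for x
  proof -
    obtain q where "norm x < q" "q < 1"
      using dense[of "norm x" 1] x by auto
    then have "summable (\<lambda>n. h n * x ^ n)"
      using powser_inside[of h q x] assms[of q] by (auto simp: sums_iff)
    then have "(\<lambda>n. x * (h n * x ^ n)) sums f x"
      unfolding f_def by (intro sums_mult summable_sums)
    then show ?thesis
      using sums_Suc[of "\<lambda>n. a n * x ^ n" "f x"] by (simp add: a_def mult_ac)
  qed
  obtain s where s: "0 < s" "\<And>z. z \<in> cball 0 s - {0} \<Longrightarrow> f z \<noteq> 0"
    using powser_0_nonzero[of 1 0 a f "Suc n", OF _ sums] n by (auto simp: f_def a_def)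
  have "f (min s (1/2)) = 0"
    using assms[of "min s (1/2)"] s(1) by (simp add: f_def sums_iff)
  moreover have "min s (1/2) \<in> cball 0 s - {0}"
    using s(1) by auto
  ultimately show False
    using s(2) by blast
qed

text \<open>The relation between the sums says that a(n) - b(n - k) can be nonzero only at the
  exponent \<open>j\<close> of the correction term \<open>e * q ^ j\<close>; \<open>h\<close> is the
  coefficient sequence of the difference.\<close>

lemma powser_shift_eq:
  fixes a b :: "nat \<Rightarrow> nat" and e :: real
  assumes "\<And>q :: real. 0 < q \<Longrightarrow> q < 1 \<Longrightarrow>
      \<exists>A B. (\<lambda>n. a n * q ^ n) sums A \<and> (\<lambda>n. b n * q ^ n) sums B \<and> A = e * q ^ j + q ^ k * B"
    and n: "n \<ge> k" "n \<noteq> j"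
  shows "a n = b (n - k)"
proof -
  define h where "h n = real (a n) - (if k \<le> n then real (b (n - k)) else 0) - (if n = j then e else 0)" for n
  have "(\<lambda>n. h n * q ^ n) sums 0" if q: "0 < q" "q < 1" for q
  proof -
    obtain A B where A: "(\<lambda>n. a n * q ^ n) sums A" and B: "(\<lambda>n. b n * q ^ n) sums B"
      and AB: "A = e * q ^ j + q ^ k * B"
      using assms(1)[OF q] by blast
    have "(\<lambda>n. if k \<le> n then q ^ k * (b (n - k) * q ^ (n - k)) else 0) sums (q ^ k * B)"
      using sums_iff_shift[of "\<lambda>n. if k \<le> n then q ^ k * (b (n - k) * q ^ (n - k)) else 0" k "q ^ k * B"]
        sums_mult[OF B, of "q ^ k"] by simp
    from sums_diff[OF sums_diff[OF A this] sums_single[of j "\<lambda>n. e * q ^ n"]]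
    have "(\<lambda>n. a n * q ^ n - (if k \<le> n then q ^ k * (b (n - k) * q ^ (n - k)) else 0) - (if n = j then e * q ^ n else 0)) sums 0"
      by (simp add: AB)
    moreover have "h n * q ^ n = a n * q ^ n - (if k \<le> n then q ^ k * (b (n - k) * q ^ (n - k)) else 0) -
        (if n = j then e * q ^ n else 0)" for n
    proof -
      have "q ^ n = q ^ k * q ^ (n - k)" if "k \<le> n"
        using that by (simp flip: power_add)
      then show ?thesis
        by (auto simp: h_def algebra_simps)
    qed
    ultimately show ?thesis
      by simp
  qed
  from powser_zero_coeff[of h n, OF this] n show ?thesis
    by (simp add: h_def)
qed

section \<open>Products over symmetric residue classes\<close>

text \<open>For 0 < r < M/2 the least residues of r and -r are r and M - r. Neither is 0, so
  positivity of \<open>n\<close> is automatic.\<close>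

lemma mem_pm_residues_iff:
  assumes R: "\<And>r. r \<in> R \<Longrightarrow> 0 < r \<and> 2 * r < int M"
  shows "n \<in> pm_residues R (int M) \<longleftrightarrow> int (n mod M) \<in> R \<or> int M - int (n mod M) \<in> R"
proof -
  have 1: "[int n = r] (mod int M) \<longleftrightarrow> int (n mod M) = r" if "r \<in> R" for r
    using R[OF that] by (simp add: Cong.cong_def zmod_int)
  have 2: "[int n = - r] (mod int M) \<longleftrightarrow> int M - int (n mod M) = r" if "r \<in> R" for r
  proof -
    have "(- r) mod int M = (int M - r) mod int M"
      by simp
    also have "\<dots> = int M - r"
      using R[OF that] by (intro mod_pos_pos_trivial) auto
    finally show ?thesis
      by (auto simp: Cong.cong_def zmod_int)
  qed
  have "n > 0" if "int (n mod M) \<in> R \<or> int M - int (n mod M) \<in> R"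
    using that R[of "int (n mod M)"] R[of "int M - int (n mod M)"] by (cases n) auto
  then show ?thesis
    unfolding pm_residues_def using 1 2 by blast
qed

text \<open>Induction over blocks of length \<open>M\<close>. The bound 2r < M keeps the residues r
  and M - r' apart, so no factor is taken twice.\<close>

lemma prod_pm_residues:
  fixes g :: "nat \<Rightarrow> 'a :: comm_monoid_mult"
  assumes "finite R" and R: "\<And>r. r \<in> R \<Longrightarrow> 0 < r \<and> 2 * r < int M"
  shows "(\<Prod>k\<in>pm_residues R (int M) \<inter> {..<N * M}. g k) =
    (\<Prod>r\<in>R. (\<Prod>i<N. g (i * M + nat r)) * (\<Prod>i<N. g (i * M + (M - nat r))))"
proof (induction N)
  case (Suc N)
  let ?S = "pm_residues R (int M)"
  let ?A = "(\<lambda>r. N * M + nat r) ` R" and ?B = "(\<lambda>r. N * M + (M - nat r)) ` R"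
  have "?S \<inter> {..<Suc N * M} = (?S \<inter> {..<N * M}) \<union> (?A \<union> ?B)"
  proof (intro equalityI subsetI)
    fix k assume k: "k \<in> ?S \<inter> {..<Suc N * M}"
    show "k \<in> (?S \<inter> {..<N * M}) \<union> (?A \<union> ?B)"
    proof (cases "k < N * M")
      case False
      define r where "r = k - N * M"
      have r: "k = N * M + r" "r < M"
        using False k by (auto simp: r_def)
      then have "k mod M = r"
        by simp
      then have "int r \<in> R \<or> int M - int r \<in> R"
        using k mem_pm_residues_iff[OF R, where n = k] by auto
      then show ?thesis
      proof
        assume "int r \<in> R"
        then have "k \<in> ?A"
          using r by (intro image_eqI[of _ _ "int r"]) auto
        then show ?thesis by blast
      next
        assume "int M - int r \<in> R"
        then have "k \<in> ?B"
          using r by (intro image_eqI[of _ _ "int M - int r"]) auto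
        then show ?thesis by blast
      qed
    qed (use k in auto)
  next
    fix k assume "k \<in> (?S \<inter> {..<N * M}) \<union> (?A \<union> ?B)"
    then consider "k \<in> ?S" "k < N * M" | r where "r \<in> R" "k = N * M + nat r"
      | r where "r \<in> R" "k = N * M + (M - nat r)"
      by blast
    then show "k \<in> ?S \<inter> {..<Suc N * M}"
    proof cases
      case 1
      then show ?thesis by auto
    next
      case (2 r)
      then have "nat r < M" "int (nat r) = r"
        using R[of r] by auto
      with 2 show ?thesis
        by (simp add: mem_pm_residues_iff[OF R])
    next
      case (3 r)
      define s where "s = M - nat r"
      have "k = N * M + s" "s < M" "int M - int s = r"
        using 3 R[of r] by (auto simp: s_def)
      with 3(1) show ?thesis
        by (simp add: mem_pm_residues_iff[OF R])
    qed
  qed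
  moreover have "(?S \<inter> {..<N * M}) \<inter> (?A \<union> ?B) = {}"
    by auto
  moreover have "?A \<inter> ?B = {}"
  proof -
    have "nat r \<noteq> M - nat r'" if "r \<in> R" "r' \<in> R" for r r'
      using R[OF that(1)] R[OF that(2)] by auto
    then show ?thesis by auto
  qed
  moreover have "inj_on (\<lambda>r. N * M + nat r) R" "inj_on (\<lambda>r. N * M + (M - nat r)) R"
    using R by (fastforce simp: inj_on_def)+
  ultimately show ?case
    using assms(1) Suc.IH by (simp add: prod.union_disjoint prod.reindex prod.distrib mult_ac)
qed auto

text \<open>The products truncated at N * M are products of N-th partial products of the theta
  functions. They are real and nonnegative, hence so is their limit; it is nonzero because each q^r
  lies in the annulus |q^M| < |z| < 1.\<close>

lemma sums_partition_count_pm_residues: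
  fixes q :: real
  assumes q: "0 < q" "q < 1" and "finite R" and R: "\<And>r. r \<in> R \<Longrightarrow> 0 < r \<and> 2 * r < int M" and M: "M > 0"
  shows "\<exists>L. L \<noteq> 0 \<and> complex_of_real L = (\<Prod>r\<in>R. theta (complex_of_real q ^ nat r) (complex_of_real q ^ M)) \<and>
    (\<lambda>n. partition_count (pm_residues R (int M)) n * q ^ n) sums inverse L"
proof -
  define S where "S = pm_residues R (int M)"
  define P where "P N = (\<Prod>k\<in>S \<inter> {..<N * M}. 1 - q ^ k)" for N
  define \<Theta> where "\<Theta> = (\<Prod>r\<in>R. theta (complex_of_real q ^ nat r) (complex_of_real q ^ M))"
  have qM: "norm (complex_of_real q ^ M) < 1"
    using q M by (simp add: norm_power power_less_one_iff)
  have "(\<lambda>N. complex_of_real (P N)) \<longlonglongrightarrow> \<Theta>"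
  proof -
    have "complex_of_real (P N) = (\<Prod>r\<in>R. (\<Prod>i<N. 1 - complex_of_real q ^ nat r * (complex_of_real q ^ M) ^ i) *
        (\<Prod>i<N. 1 - complex_of_real q ^ (M - nat r) * (complex_of_real q ^ M) ^ i))" for N
    proof -
      have "P N = (\<Prod>r\<in>R. (\<Prod>i<N. 1 - q ^ (i * M + nat r)) * (\<Prod>i<N. 1 - q ^ (i * M + (M - nat r))))"
        unfolding P_def S_def by (rule prod_pm_residues[OF assms(3) R])
      then show ?thesis
        by (simp add: power_add mult_ac flip: power_mult)
    qed
    moreover have "\<Theta> = (\<Prod>r\<in>R. qpoch (complex_of_real q ^ nat r) (complex_of_real q ^ M) *
        qpoch (complex_of_real q ^ (M - nat r)) (complex_of_real q ^ M))"
      unfolding \<Theta>_def theta_def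
    proof (intro prod.cong refl)
      fix r assume "r \<in> R"
      then have "nat r \<le> M"
        using R[of r] by auto
      then show "qpoch (complex_of_real q ^ nat r) (complex_of_real q ^ M) *
          qpoch (complex_of_real q ^ M / complex_of_real q ^ nat r) (complex_of_real q ^ M) =
          qpoch (complex_of_real q ^ nat r) (complex_of_real q ^ M) *
          qpoch (complex_of_real q ^ (M - nat r)) (complex_of_real q ^ M)"
        using q by (simp add: power_diff)
    qed
    ultimately show ?thesis
      by (auto intro!: tendsto_prod tendsto_mult qpoch_LIMSEQ[OF qM])
  qed
  note lim = this
  have "P \<longlonglongrightarrow> Re \<Theta>"
    using tendsto_Re[OF lim] by simp
  then have L: "complex_of_real (Re \<Theta>) = \<Theta>"
    using LIMSEQ_unique[OF lim tendsto_of_real] by metis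
  have "\<Theta> \<noteq> 0"
  proof -
    have "theta (complex_of_real q ^ nat r) (complex_of_real q ^ M) \<noteq> 0" if "r \<in> R" for r
    proof (rule theta_nonzero[OF qM])
      have "0 < nat r" "nat r < M"
        using R[OF that] by auto
      then show "norm (complex_of_real q ^ nat r) < 1"
        "norm (complex_of_real q ^ M) < norm (complex_of_real q ^ nat r)"
        using q by (simp_all add: norm_power power_less_one_iff power_strict_decreasing)
    qed
    then show ?thesis
      by (simp add: \<Theta>_def assms(3))
  qed
  with L have "Re \<Theta> \<noteq> 0"
    by auto
  moreover have "Re \<Theta> \<ge> 0"
  proof (rule LIMSEQ_le_const[OF \<open>P \<longlonglongrightarrow> Re \<Theta>\<close>], intro exI allI impI)
    show "0 \<le> P N" for N
      unfolding P_def using q by (intro prod_nonneg) (auto simp: power_le_one)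
  qed
  moreover have "0 \<notin> S"
    by (simp add: S_def pm_residues_def)
  ultimately have "(\<lambda>n. partition_count S n * q ^ n) sums inverse (Re \<Theta>)"
    using \<open>P \<longlonglongrightarrow> Re \<Theta>\<close> unfolding P_def by (intro sums_partition_count[OF q _ M]) auto
  with L \<open>Re \<Theta> \<noteq> 0\<close> show ?thesis
    unfolding \<Theta>_def S_def by metis
qed

section \<open>Theta identities modulo 40\<close>

text \<open>The choice x = -a, y = -b, u = a, v = e makes the two products on the left sign changes
  of each other and turns the argument x/u into -1.\<close>

lemma theta_quartic:
  assumes t: "norm t < 1" "t \<noteq> 0" and nz: "a \<noteq> 0" "b \<noteq> 0" "e \<noteq> 0"
  defines "\<theta> \<equiv> \<lambda>z. theta z (t ^ 4)"
  shows "\<theta> (a * b) * \<theta> (a / b) * \<theta> (a * e) * \<theta> (a / e) -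
      \<theta> (- (a * b)) * \<theta> (- (a / b)) * \<theta> (- (a * e)) * \<theta> (- (a / e)) =
    - (a / b) * (\<theta> (- (b * e)) * \<theta> (- (b / e)) * \<theta> (- (a * a)) * \<theta> (- 1))"
  using weierstrass_three_term[OF t, of "- a" "- b" a e] nz unfolding \<theta>_def by (simp add: mult_ac)

text \<open>With x = -ia, y = ib, u = ia, v = -i both products on the left contain the arguments a
  and -a, leaving a quadratic expression times a common factor.\<close>

lemma theta_pair:
  assumes t: "norm t < 1" "t \<noteq> 0" and nz: "a \<noteq> 0" "b \<noteq> 0"
  defines "\<theta> \<equiv> \<lambda>z. theta z (t ^ 4)"
  shows "(\<theta> (a * b) * \<theta> (- (a / b)) - \<theta> (- (a * b)) * \<theta> (a / b)) * (\<theta> a * \<theta> (- a)) =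
    a / b * (\<theta> b * \<theta> (- b) * \<theta> (a * a) * \<theta> (- 1))"
proof -
  have i: "\<i> * (\<i> * z) = - z" for z
    by (simp flip: mult.assoc)
  show ?thesis
    using weierstrass_three_term[OF t, of "- \<i> * a" "\<i> * b" "\<i> * a" "- \<i>"] nz
    unfolding \<theta>_def by (simp add: algebra_simps i)
qed

section \<open>Theta functions of nome \<open>q ^ 20\<close> and \<open>q ^ 40\<close>\<close>

locale nome =
  fixes q :: complex
  assumes q1: "norm q < 1" and q0: "q \<noteq> 0"
begin

definition "c k = theta (q ^ k) (q ^ 20)"
definition "d k = theta (- (q ^ k)) (q ^ 20)"
text \<open>For 0 < k < 20 this collects the factors 1 - q^m with m congruent to k or -k modulo 40,
  so the reciprocal generating functions are products of values of \<open>J\<close>.\<close>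

definition "J k = theta (q ^ k) (q ^ 40)"
definition "K = theta (- 1) (q ^ 20)"

lemma norm_q_power: "n > 0 \<Longrightarrow> norm (q ^ n) < 1"
  using q1 by (simp add: norm_power power_less_one_iff)

text \<open>A class k modulo 20 splits into the classes k and k + 20 modulo 40, and k + 20 is
  congruent to -(20 - k).\<close>

lemma c_eq_J: "k \<le> 20 \<Longrightarrow> c k = J k * J (20 - k)"
  using theta_split[of "q ^ 20" "q ^ k"] norm_q_power[of 20] q0
  by (simp add: c_def J_def power_diff flip: power_mult)

lemma J_double: "J (2 * k) = c k * d k"
  using theta_mult_minus[of "q ^ 20" "q ^ k"] norm_q_power[of 20]
  by (simp add: c_def d_def J_def mult.commute flip: power_mult)

lemma c_reflect: "k \<le> 20 \<Longrightarrow> c (20 - k) = c k"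
  using theta_reflect[of "q ^ 20" "q ^ k"] q0 by (simp add: c_def power_diff)

lemma d_reflect: "k \<le> 20 \<Longrightarrow> d (20 - k) = d k"
  using theta_reflect[of "q ^ 20" "- (q ^ k)"] q0 by (simp add: d_def power_diff)

lemma theta_fold:
  "theta (q ^ u * q ^ v) (q ^ 20) = c (u + v)" "theta (- (q ^ u * q ^ v)) (q ^ 20) = d (u + v)"
  "theta (q ^ u) (q ^ 20) = c u" "theta (- (q ^ u)) (q ^ 20) = d u" "theta (- 1) (q ^ 20) = K"
  by (simp_all add: c_def d_def K_def power_add)

lemma theta_power_diff:
  "k \<le> l \<Longrightarrow> theta (q ^ l / q ^ k) (q ^ 20) = c (l - k)"
  "k \<le> l \<Longrightarrow> theta (- (q ^ l / q ^ k)) (q ^ 20) = d (l - k)"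
  using q0 by (simp_all add: c_def d_def power_diff)

text \<open>Negative exponents are inverted away; the sign from \<open>theta_inverse\<close>
  survives for \<open>c\<close> and cancels for \<open>d\<close>.\<close>

lemma theta_power_diff':
  assumes "k \<le> l"
  shows "theta (q ^ k / q ^ l) (q ^ 20) = - c (l - k) / q ^ (l - k)"
    "theta (- (q ^ k / q ^ l)) (q ^ 20) = d (l - k) / q ^ (l - k)"
proof -
  have "q ^ k / q ^ l = inverse (q ^ (l - k))"
    using assms q0 by (simp add: power_diff)
  then show "theta (q ^ k / q ^ l) (q ^ 20) = - c (l - k) / q ^ (l - k)"
    "theta (- (q ^ k / q ^ l)) (q ^ 20) = d (l - k) / q ^ (l - k)"
    using theta_inverse[of "q ^ 20" "q ^ (l - k)"] theta_inverse[of "q ^ 20" "- (q ^ (l - k))"]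
      norm_q_power[of 20] q0 by (simp_all add: c_def d_def)
qed

text \<open>The three-term relation has nome \<open>t ^ 4\<close>, so \<open>t = q ^ 5\<close>
  yields nome \<open>q ^ 20\<close>.\<close>

lemma q5: "norm (q ^ 5) < 1" "q ^ 5 \<noteq> 0" "(q ^ 5) ^ 4 = q ^ 20"
  using q0 norm_q_power[of 5] by (simp_all flip: power_mult)

lemma quartic_diff:
  assumes "y \<le> u" "v \<le> y"
  shows "c (u + y) * c (u - y) * c (u + v) * c (u - v) - d (u + y) * d (u - y) * d (u + v) * d (u - v) =
    - (q ^ (u - y)) * (d (y + v) * d (y - v) * d (2 * u) * K)"
proof -
  have "v \<le> u" "q ^ u / q ^ y = q ^ (u - y)"
    using assms q0 by (simp_all add: power_diff)
  with assms show ?thesis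
    using theta_quartic[OF q5(1,2), of "q ^ u" "q ^ y" "q ^ v"] q0
    unfolding q5(3) mult_2 by (simp add: theta_power_diff theta_fold)
qed

text \<open>Now a/e and b/e are negative powers of \<open>q\<close>. Inverting a/e changes the sign
  of \<open>c\<close> only, which turns the difference into a sum, and all powers of
  \<open>q\<close> cancel.\<close>

lemma quartic_sum:
  assumes "y \<le> u" "u \<le> v"
  shows "c (u + y) * c (u - y) * c (u + v) * c (v - u) + d (u + y) * d (u - y) * d (u + v) * d (v - u) =
    d (y + v) * d (v - y) * d (2 * u) * K"
proof -
  have le: "y \<le> v" and e: "q ^ u / q ^ y = q ^ (u - y)" "q ^ (v - y) = q ^ (v - u) * q ^ (u - y)"
    using assms q0 by (simp_all add: power_diff)
  have "q ^ u \<noteq> 0" "q ^ y \<noteq> 0" "q ^ v \<noteq> 0"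
    using q0 by auto
  from theta_quartic[OF q5(1,2) this]
  have "- (c (u + y) * c (u - y) * c (u + v) * c (v - u) + d (u + y) * d (u - y) * d (u + v) * d (v - u)) / q ^ (v - u) =
     - (q ^ (u - y)) * (d (y + v) * (d (v - y) / q ^ (v - y)) * d (2 * u) * K)"
    using assms le q0 unfolding q5(3) mult_2
    by (simp add: theta_power_diff theta_power_diff' theta_fold e(1) diff_divide_distrib)
  also have "\<dots> = - (d (y + v) * d (v - y) * d (2 * u) * K) / q ^ (v - u)"
    using q0 by (simp add: e(2))
  finally show ?thesis
    using q0 by (simp only: divide_cancel_right neg_equal_iff_equal power_eq_0_iff simp_thms)
qed

lemma J_nonzero: "0 < k \<Longrightarrow> k < 40 \<Longrightarrow> J k \<noteq> 0"
  unfolding J_def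
  using q1 q0 norm_q_power[of k] norm_q_power[of 40]
  by (intro theta_nonzero) (auto simp: norm_power power_strict_decreasing)

text \<open>The factor \<open>J (2 * u)\<close> is cancelled from \<open>theta_pair\<close>, using
  c(2u) = J(2u) J(20 - 2u); the range of \<open>u\<close> makes this valid and the factor
  nonzero.\<close>

lemma pair_diff:
  assumes "y \<le> u" "0 < u" "u \<le> 10"
  shows "c (u + y) * d (u - y) - d (u + y) * c (u - y) = q ^ (u - y) * (J (2 * y) * J (20 - 2 * u) * K)"
proof -
  have "q ^ u / q ^ y = q ^ (u - y)"
    using assms q0 by (simp add: power_diff)
  with assms have "(c (u + y) * d (u - y) - d (u + y) * c (u - y)) * J (2 * u) = q ^ (u - y) * (J (2 * y) * c (2 * u) * K)"
    using theta_pair[OF q5(1,2), of "q ^ u" "q ^ y"] q0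
    unfolding q5(3) J_double unfolding mult_2 by (simp add: theta_power_diff theta_fold)
  then show ?thesis
    using c_eq_J[of "2 * u"] J_nonzero[of "2 * u"] assms by simp
qed

lemma pair_sum:
  assumes "u \<le> y" "0 < u" "u \<le> 10"
  shows "c (u + y) * d (y - u) + d (u + y) * c (y - u) = J (2 * y) * J (20 - 2 * u) * K"
proof -
  have e: "q ^ u / q ^ y = inverse (q ^ (y - u))"
    using assms q0 by (simp add: power_diff)
  have "q ^ u \<noteq> 0" "q ^ y \<noteq> 0"
    using q0 by auto
  from theta_pair[OF q5(1,2) this]
  have "(c (u + y) * d (y - u) + d (u + y) * c (y - u)) * J (2 * u) / q ^ (y - u) =
     J (2 * y) * c (2 * u) * K / q ^ (y - u)"
    unfolding q5(3) J_double unfolding mult_2 theta_power_diff'[OF assms(1)] unfolding e theta_fold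
    by (simp add: divide_inverse algebra_simps)
  then have "(c (u + y) * d (y - u) + d (u + y) * c (y - u)) * J (2 * u) = J (2 * y) * c (2 * u) * K"
    using q0 by simp
  then show ?thesis
    using c_eq_J[of "2 * u"] J_nonzero[of "2 * u"] assms by simp
qed

text \<open>The argument -1 has norm 1, so the head factor 1 - (-1) = 2 is split off before the
  criterion for nonvanishing applies.\<close>

lemma K_nonzero: "K \<noteq> 0"
proof -
  have "qpoch (- 1) (q ^ 20) = 2 * qpoch (- (q ^ 20)) (q ^ 20)"
    using qpoch_head[of "q ^ 20" "- 1"] norm_q_power[of 20] by simp
  then show ?thesis
    using qpoch_nonzero[of "q ^ 20" "- (q ^ 20)"] norm_q_power[of 20]
    by (simp add: K_def theta_def)
qed

section \<open>Relations among the even and odd indices\<close>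

text \<open>c(2k) = J(2k) J(20 - 2k), and \<open>J_double\<close> resolves both factors at k and 10
  - k.\<close>

lemma residue_relations:
  "c 2 = c 1 * d 1 * (c 9 * d 9)" "c 4 = c 2 * d 2 * (c 8 * d 8)"
  "c 6 = c 3 * d 3 * (c 7 * d 7)" "c 8 = c 4 * d 4 * (c 6 * d 6)"
  using c_eq_J[of 2] c_eq_J[of 4] c_eq_J[of 6] c_eq_J[of 8]
    J_double[of 1] J_double[of 2] J_double[of 3] J_double[of 4] J_double[of 6]
    J_double[of 7] J_double[of 8] J_double[of 9]
  by (simp_all add: mult_ac)

text \<open>Each relation omits one of the odd indices 7, 9, 1, 3, in this order. Indices above 10
  are folded back by k -> 20 - k.\<close>

lemma quartic_relations:
  "c 1 * c 3 * c 5 * c 9 + d 1 * d 3 * d 5 * d 9 = K * (d 4 * d 6 * d 8)"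
  "c 1 * c 3 * c 5 * c 7 - d 1 * d 3 * d 5 * d 7 = - q * (K * (d 2 * d 4 * d 8))"
  "c 3 * c 5 * c 7 * c 9 - d 3 * d 5 * d 7 * d 9 = - (q ^ 3) * (K * (d 2 * d 4 * d 8))"
  "c 1 * c 5 * c 7 * c 9 - d 1 * d 5 * d 7 * d 9 = - q * (K * (d 4 * d 6 * d 8))"
  using quartic_sum[of 1 2 7] quartic_diff[of 3 4 1] quartic_diff[of 3 6 1] quartic_diff[of 6 7 2]
    c_reflect[of 7] d_reflect[of 7] d_reflect[of 6] d_reflect[of 8]
  by (simp_all add: mult_ac)

lemma pair_relations:
  "c 9 * d 7 + d 9 * c 7 = K * (c 8 * d 8 * (c 9 * d 9))"
  "c 7 * d 1 + d 7 * c 1 = K * (c 4 * d 4 * (c 7 * d 7))"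
  "c 3 * d 9 - d 3 * c 9 = - (q ^ 3) * (K * (c 4 * d 4 * (c 3 * d 3)))"
  "c 1 * d 3 - d 1 * c 3 = - q * (K * (c 8 * d 8 * (c 1 * d 1)))"
proof -
  show "c 9 * d 7 + d 9 * c 7 = K * (c 8 * d 8 * (c 9 * d 9))"
    using pair_sum[of 1 8] J_double[of 8] J_double[of 9] by (simp add: mult_ac)
  show "c 7 * d 1 + d 7 * c 1 = K * (c 4 * d 4 * (c 7 * d 7))"
    using pair_sum[of 3 4] J_double[of 4] J_double[of 7] by (simp add: mult_ac)
  show "c 3 * d 9 - d 3 * c 9 = - (q ^ 3) * (K * (c 4 * d 4 * (c 3 * d 3)))"
    using pair_diff[of 3 6] J_double[of 4] J_double[of 3] by (simp add: algebra_simps)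
  show "c 1 * d 3 - d 1 * c 3 = - q * (K * (c 8 * d 8 * (c 1 * d 1)))"
    using pair_diff[of 1 2] J_double[of 8] J_double[of 1] by (simp add: algebra_simps numeral_3_eq_3)
qed

end

text \<open>The four parts of the theorem are conjugate under multiplication of all residues by 1, 3, 7, 9
  modulo 20, up to the signs \<open>s\<close>, \<open>s'\<close> and the monomials \<open>e1\<close>, \<open>e2\<close>, \<open>e3\<close>. Eliminating the product
  \<open>d1 d3 d5 d7 d9\<close> from the two quartic relations leaves the pair relation as a common factor.\<close>

lemma conjugate_identity:
  fixes c1 c2 c3 c4 c5 c6 c7 c8 c9 d1 d2 d3 d4 d5 d6 d7 d8 d9 K s s' e1 e2 e3 :: "'a :: field"
  assumes c4: "c4 = c2 * d2 * (c8 * d8)" and r: "c2 = c1 * d1 * (c9 * d9)"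
      "c6 = c3 * d3 * (c7 * d7)" "c8 = c4 * d4 * (c6 * d6)"
    and s: "s * s = 1" "s' * s' = 1"
    and I1: "c1 * c3 * c5 * c9 + s * (d1 * d3 * d5 * d9) = e1 * (K * (d4 * d6 * d8))"
    and I2: "c1 * c3 * c5 * c7 + s' * (d1 * d3 * d5 * d7) = e2 * (K * (d2 * d4 * d8))"
    and I3: "c9 * d7 - s * s' * (d9 * c7) = e3 * (K * (c8 * d8 * (c9 * d9)))"
    and nz: "e3 * (K * (c8 * d8 * (c9 * d9))) \<noteq> 0"
  shows "e3 * ((c1 * c3 * c5 * c7 * c9) * (c2 * c4 * (c3 * d3) * (c6 * d6))) =
    e1 * (c9 * (c1 * d1) * (c6 * d6)) - s * s' * e2 * (c7 * (c2 * d2) * (c3 * d3))"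
proof -
  define A where "A = c1 * d1 * (c6 * d6)"
  define B where "B = c2 * d2 * (c3 * d3)"
  define C where "C = c2 * c4 * (c3 * d3) * (c6 * d6)"
  define F where "F = c1 * c3 * c5 * c7 * c9"
  define G where "G = d1 * d3 * d5 * d7 * d9"
  \<comment> \<open>\<open>E1\<close> and \<open>E2\<close> below form a linear system for
    \<open>F\<close> and \<open>G\<close>, whose determinant is \<open>Z\<close> up to sign and the
    factor \<open>e3 * C\<close>. The pair relation evaluates \<open>Z\<close> and shows that it may
    be cancelled.\<close>
  define Z where "Z = c9 * d7 - s * s' * (d9 * c7)"
  have Z: "Z = e3 * (K * (c8 * d8 * (c9 * d9)))" and Z0: "Z \<noteq> 0"
    using I3 nz by (simp_all add: Z_def)
  have m1: "d4 * d6 * d8 * (C * (c7 * d7)) = A * (c8 * d8 * (c9 * d9))"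
  proof -
    have "d4 * d6 * d8 * (C * (c7 * d7)) = c2 * (c4 * d4 * (c6 * d6)) * d6 * d8 * (c3 * d3 * (c7 * d7))"
      by (simp add: C_def mult_ac)
    also have "\<dots> = c2 * c8 * d6 * d8 * c6"
      by (simp flip: r)
    also have "\<dots> = A * (c8 * d8 * (c9 * d9))"
      unfolding A_def r(1) by (simp add: mult_ac)
    finally show ?thesis .
  qed
  have m2: "d2 * d4 * d8 * C = B * (c8 * d8)"
  proof -
    have "d2 * d4 * d8 * C = c2 * d2 * (c3 * d3) * ((c4 * d4 * (c6 * d6)) * d8)"
      by (simp add: C_def mult_ac)
    then show ?thesis
      by (simp add: B_def flip: r)
  qed
  \<comment> \<open>Multiplying the first quartic relation by the missing pair c7 d7 expresses it
    through the full products \<open>F\<close> and \<open>G\<close>.\<close>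
  have "e3 * C * (F * d7 + s * G * c7) =
      e3 * (C * (c7 * d7)) * (c1 * c3 * c5 * c9 + s * (d1 * d3 * d5 * d9))"
    unfolding F_def G_def by (simp add: algebra_simps)
  also have "\<dots> = e1 * e3 * K * (d4 * d6 * d8 * (C * (c7 * d7)))"
    unfolding I1 by (simp add: mult_ac)
  also have "\<dots> = e1 * A * Z"
    unfolding m1 Z by (simp add: mult_ac)
  finally have E1: "e3 * C * (F * d7 + s * G * c7) = e1 * A * Z" .
  have "e3 * C * (F * d9 + s' * G * c9) =
      e3 * (C * (c9 * d9)) * (c1 * c3 * c5 * c7 + s' * (d1 * d3 * d5 * d7))"
    unfolding F_def G_def by (simp add: algebra_simps)
  also have "\<dots> = e2 * e3 * K * (c9 * d9) * (d2 * d4 * d8 * C)"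
    unfolding I2 by (simp add: mult_ac)
  also have "\<dots> = e2 * B * Z"
    unfolding m2 Z by (simp add: mult_ac)
  finally have E2: "e3 * C * (F * d9 + s' * G * c9) = e2 * B * Z" .
  \<comment> \<open>\<open>G\<close> is eliminated by c9 times \<open>E1\<close> minus s s' c7 times
    \<open>E2\<close>; here s' s' = 1 makes the two terms in \<open>G\<close> agree.\<close>
  have "s * s' * c7 * (e3 * C * (F * d9 + s' * G * c9)) =
      s * s' * c7 * (e3 * C * F * d9) + (s' * s') * (e3 * C * (s * G * c7) * c9)"
    by (simp add: algebra_simps)
  then have "e3 * C * F * Z = c9 * (e3 * C * (F * d7 + s * G * c7)) - s * s' * c7 * (e3 * C * (F * d9 + s' * G * c9))"
    unfolding Z_def by (simp add: algebra_simps s)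
  also have "\<dots> = (e1 * (c9 * A) - s * s' * e2 * (c7 * B)) * Z"
    unfolding E1 E2 by (simp add: algebra_simps)
  finally have "e3 * C * F = e1 * (c9 * A) - s * s' * e2 * (c7 * B)"
    using Z0 by simp
  then show ?thesis
    by (simp add: A_def B_def C_def F_def mult_ac)
qed

section \<open>The four product identities\<close>

context nome
begin

text \<open>The two residue sets of each part share eight residues. \<open>G\<close> is their
  product, \<open>X\<close> and \<open>Y\<close> are the products over the four remaining residues
  of \<open>S\<close> and of \<open>T\<close>.\<close>

lemma common_factor:
  fixes X Y G a b :: complex
  assumes "Y - a * X = b * (G * X * Y)"
  shows "G * Y - a * (G * X) = b * ((G * X) * (G * Y))"
proof -
  have "G * Y - a * (G * X) = G * (Y - a * X)"
    by (simp add: algebra_simps)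
  then show ?thesis
    unfolding assms by (simp add: mult_ac)
qed

lemma c_d_nonzero: "0 < k \<Longrightarrow> k < 20 \<Longrightarrow> c k \<noteq> 0 \<and> d k \<noteq> 0"
  using J_double[of k] J_nonzero[of "2 * k"] by auto

lemma theta_identity_1:
  "J 2 * J 9 * J 11 * J 12 - q * (J 4 * J 6 * J 7 * J 13) =
    1 * ((J 1 * J 3 * J 5 * J 15 * J 16 * J 17 * J 18 * J 19) * (J 4 * J 6 * J 7 * J 13) * (J 2 * J 9 * J 11 * J 12))"
proof -
  \<comment> \<open>The constants stay unsimplified so that the rule matches: s = 1, s' = -1, e1 =
    1, e2 = -q, e3 = 1.\<close>
  have "1 * ((c 1 * c 3 * c 5 * c 7 * c 9) * (c 2 * c 4 * (c 3 * d 3) * (c 6 * d 6))) =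
    1 * (c 9 * (c 1 * d 1) * (c 6 * d 6)) - 1 * (- 1) * (- q) * (c 7 * (c 2 * d 2) * (c 3 * d 3))"
    by (rule conjugate_identity[where K = K and ?d4.0 = "d 4" and ?d5.0 = "d 5" and ?d7.0 = "d 7" and
          ?c8.0 = "c 8" and ?d8.0 = "d 8" and ?d9.0 = "d 9"])
       (use residue_relations quartic_relations pair_relations K_nonzero c_d_nonzero[of 8] c_d_nonzero[of 9] in simp_all)
  then show ?thesis
    using c_eq_J[of 1] c_eq_J[of 2] c_eq_J[of 3] c_eq_J[of 4] c_eq_J[of 5] c_eq_J[of 7] c_eq_J[of 9]
      J_double[of 1] J_double[of 2] J_double[of 3] J_double[of 6]
    by (simp add: mult_ac)
qed

lemma theta_product_1:
  "(\<Prod>r\<in>{1, 2, 3, 5, 9, 11, 12, 15, 16, 17, 18, 19}. theta (q ^ nat r) (q ^ 40)) -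
      q ^ 1 * (\<Prod>r\<in>{1, 3, 4, 5, 6, 7, 13, 15, 16, 17, 18, 19}. theta (q ^ nat r) (q ^ 40)) =
    of_real 1 * q ^ 0 * ((\<Prod>r\<in>{1, 3, 4, 5, 6, 7, 13, 15, 16, 17, 18, 19}. theta (q ^ nat r) (q ^ 40)) *
      (\<Prod>r\<in>{1, 2, 3, 5, 9, 11, 12, 15, 16, 17, 18, 19}. theta (q ^ nat r) (q ^ 40)))"
  using common_factor[OF theta_identity_1] by (simp add: J_def mult_ac)

text \<open>The conjugate under multiplication by 3: the indices 1, 3, 5, 7, 9 become 3, 9, 5, 1, 7
  modulo 20 up to sign.\<close>

lemma theta_identity_2:
  "J 1 * J 12 * J 18 * J 19 - q ^ 3 * (J 4 * J 6 * J 7 * J 13) =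
    1 * ((J 3 * J 5 * J 8 * J 9 * J 11 * J 14 * J 15 * J 17) * (J 4 * J 6 * J 7 * J 13) * (J 1 * J 12 * J 18 * J 19))"
proof -
  have "1 * ((c 3 * c 9 * c 5 * c 1 * c 7) * (c 6 * c 8 * (c 9 * d 9) * (c 2 * d 2))) =
    - (q ^ 3) * (c 7 * (c 3 * d 3) * (c 2 * d 2)) - (- 1) * 1 * 1 * (c 1 * (c 6 * d 6) * (c 9 * d 9))"
    by (rule conjugate_identity[where K = K and ?d4.0 = "d 8" and ?d5.0 = "d 5" and ?d7.0 = "d 1" and
          ?c8.0 = "c 4" and ?d8.0 = "d 4" and ?d9.0 = "d 7"])
       (use residue_relations quartic_relations pair_relations K_nonzero c_d_nonzero[of 4] c_d_nonzero[of 7] in \<open>simp_all add: mult_ac\<close>)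
  then show ?thesis
    using c_eq_J[of 1] c_eq_J[of 3] c_eq_J[of 5] c_eq_J[of 6] c_eq_J[of 7] c_eq_J[of 8] c_eq_J[of 9]
      J_double[of 2] J_double[of 3] J_double[of 6] J_double[of 9]
    by (simp add: mult_ac)
qed

lemma theta_product_2:
  "(\<Prod>r\<in>{1, 3, 5, 8, 9, 11, 12, 14, 15, 17, 18, 19}. theta (q ^ nat r) (q ^ 40)) -
      q ^ 3 * (\<Prod>r\<in>{3, 4, 5, 6, 7, 8, 9, 11, 13, 14, 15, 17}. theta (q ^ nat r) (q ^ 40)) =
    of_real 1 * q ^ 0 * ((\<Prod>r\<in>{3, 4, 5, 6, 7, 8, 9, 11, 13, 14, 15, 17}. theta (q ^ nat r) (q ^ 40)) *
      (\<Prod>r\<in>{1, 3, 5, 8, 9, 11, 12, 14, 15, 17, 18, 19}. theta (q ^ nat r) (q ^ 40)))"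
  using common_factor[OF theta_identity_2] by (simp add: J_def mult_ac)

text \<open>The conjugate under multiplication by 7. Here e1 = e2 = -q but e3 = -q^3; cancelling
  \<open>q\<close> leaves the term in q^2 that makes n = 2 exceptional.\<close>

lemma theta_identity_3:
  "J 2 * J 9 * J 11 * J 12 - 1 * (J 3 * J 4 * J 14 * J 17) =
    - (q\<^sup>2) * ((J 1 * J 5 * J 6 * J 7 * J 8 * J 13 * J 15 * J 19) * (J 3 * J 4 * J 14 * J 17) * (J 2 * J 9 * J 11 * J 12))"
proof -
  have "- (q ^ 3) * ((c 7 * c 1 * c 5 * c 9 * c 3) * (c 6 * c 8 * (c 1 * d 1) * (c 2 * d 2))) =
    - q * (c 3 * (c 7 * d 7) * (c 2 * d 2)) - (- 1) * (- 1) * (- q) * (c 9 * (c 6 * d 6) * (c 1 * d 1))"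
    by (rule conjugate_identity[where K = K and ?d4.0 = "d 8" and ?d5.0 = "d 5" and ?d7.0 = "d 9" and
          ?c8.0 = "c 4" and ?d8.0 = "d 4" and ?d9.0 = "d 3"])
       (use residue_relations quartic_relations pair_relations K_nonzero q0 c_d_nonzero[of 4] c_d_nonzero[of 3] in \<open>simp_all add: mult_ac\<close>)
  then have "q * (q\<^sup>2 * ((c 7 * c 1 * c 5 * c 9 * c 3) * (c 6 * c 8 * (c 1 * d 1) * (c 2 * d 2)))) =
    q * (c 3 * (c 7 * d 7) * (c 2 * d 2) - c 9 * (c 6 * d 6) * (c 1 * d 1))"
    by (simp add: algebra_simps power2_eq_square power3_eq_cube)
  then show ?thesis
    using q0 c_eq_J[of 1] c_eq_J[of 3] c_eq_J[of 5] c_eq_J[of 6] c_eq_J[of 7] c_eq_J[of 8] c_eq_J[of 9]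
      J_double[of 1] J_double[of 2] J_double[of 6] J_double[of 7]
    by (simp add: mult_ac)
qed

lemma theta_product_3:
  "(\<Prod>r\<in>{1, 2, 5, 6, 7, 8, 9, 11, 12, 13, 15, 19}. theta (q ^ nat r) (q ^ 40)) -
      q ^ 0 * (\<Prod>r\<in>{1, 3, 4, 5, 6, 7, 8, 13, 14, 15, 17, 19}. theta (q ^ nat r) (q ^ 40)) =
    of_real (- 1) * q ^ 2 * ((\<Prod>r\<in>{1, 3, 4, 5, 6, 7, 8, 13, 14, 15, 17, 19}. theta (q ^ nat r) (q ^ 40)) *
      (\<Prod>r\<in>{1, 2, 5, 6, 7, 8, 9, 11, 12, 13, 15, 19}. theta (q ^ nat r) (q ^ 40)))"
  using common_factor[OF theta_identity_3] by (simp add: J_def mult_ac)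

text \<open>The conjugate under multiplication by 9, which reverses the odd indices; again a factor
  \<open>q\<close> cancels.\<close>

lemma theta_identity_4:
  "J 1 * J 12 * J 18 * J 19 - q\<^sup>2 * (J 3 * J 4 * J 14 * J 17) =
    1 * ((J 2 * J 5 * J 7 * J 9 * J 11 * J 13 * J 15 * J 16) * (J 3 * J 4 * J 14 * J 17) * (J 1 * J 12 * J 18 * J 19))"
proof -
  have "- q * ((c 9 * c 7 * c 5 * c 3 * c 1) * (c 2 * c 4 * (c 7 * d 7) * (c 6 * d 6))) =
    - q * (c 1 * (c 9 * d 9) * (c 6 * d 6)) - (- 1) * (- 1) * (- (q ^ 3)) * (c 3 * (c 2 * d 2) * (c 7 * d 7))"
    by (rule conjugate_identity[where K = K and ?d4.0 = "d 4" and ?d5.0 = "d 5" and ?d7.0 = "d 3" and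
          ?c8.0 = "c 8" and ?d8.0 = "d 8" and ?d9.0 = "d 1"])
       (use residue_relations quartic_relations pair_relations K_nonzero q0 c_d_nonzero[of 8] c_d_nonzero[of 1] in \<open>simp_all add: mult_ac\<close>)
  then have "q * ((c 9 * c 7 * c 5 * c 3 * c 1) * (c 2 * c 4 * (c 7 * d 7) * (c 6 * d 6))) =
    q * (c 1 * (c 9 * d 9) * (c 6 * d 6) - q\<^sup>2 * (c 3 * (c 2 * d 2) * (c 7 * d 7)))"
    by (simp add: algebra_simps power2_eq_square power3_eq_cube)
  then show ?thesis
    using q0 c_eq_J[of 1] c_eq_J[of 2] c_eq_J[of 3] c_eq_J[of 4] c_eq_J[of 5] c_eq_J[of 7] c_eq_J[of 9]
      J_double[of 2] J_double[of 6] J_double[of 7] J_double[of 9]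
    by (simp add: mult_ac)
qed

lemma theta_product_4:
  "(\<Prod>r\<in>{1, 2, 5, 7, 9, 11, 12, 13, 15, 16, 18, 19}. theta (q ^ nat r) (q ^ 40)) -
      q ^ 2 * (\<Prod>r\<in>{2, 3, 4, 5, 7, 9, 11, 13, 14, 15, 16, 17}. theta (q ^ nat r) (q ^ 40)) =
    of_real 1 * q ^ 0 * ((\<Prod>r\<in>{2, 3, 4, 5, 7, 9, 11, 13, 14, 15, 16, 17}. theta (q ^ nat r) (q ^ 40)) *
      (\<Prod>r\<in>{1, 2, 5, 7, 9, 11, 12, 13, 15, 16, 18, 19}. theta (q ^ nat r) (q ^ 40)))"
  using common_factor[OF theta_identity_4] by (simp add: J_def mult_ac)

end

section \<open>From product identities to partition counts\<close>

text \<open>Dividing the product identity by both products turns it into 1/L = e q^j + q^k / L', a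
  relation between the two generating functions.\<close>

lemma partition_count_pm_residues_shift:
  fixes e :: real and M :: nat
  assumes M: "M > 0" and fin: "finite R" "finite R'"
    and R: "\<forall>r\<in>R. 0 < r \<and> 2 * r < int M" and R': "\<forall>r\<in>R'. 0 < r \<and> 2 * r < int M"
    and eq: "\<And>q. norm q < 1 \<Longrightarrow> q \<noteq> 0 \<Longrightarrow>
      (\<Prod>r\<in>R'. theta (q ^ nat r) (q ^ M)) - q ^ k * (\<Prod>r\<in>R. theta (q ^ nat r) (q ^ M)) =
      of_real e * q ^ j * ((\<Prod>r\<in>R. theta (q ^ nat r) (q ^ M)) * (\<Prod>r\<in>R'. theta (q ^ nat r) (q ^ M)))"
    and n: "n \<ge> k" "n \<noteq> j"
  shows "partition_count (pm_residues R (int M)) n = partition_count (pm_residues R' (int M)) (n - k)"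
proof (rule powser_shift_eq[OF _ n])
  fix q :: real assume q: "0 < q" "q < 1"
  obtain L where L: "L \<noteq> 0" "complex_of_real L = (\<Prod>r\<in>R. theta (complex_of_real q ^ nat r) (complex_of_real q ^ M))"
    "(\<lambda>n. partition_count (pm_residues R (int M)) n * q ^ n) sums inverse L"
    using sums_partition_count_pm_residues[OF q fin(1) bspec[OF R] M] by blast
  obtain L' where L': "L' \<noteq> 0" "complex_of_real L' = (\<Prod>r\<in>R'. theta (complex_of_real q ^ nat r) (complex_of_real q ^ M))"
    "(\<lambda>n. partition_count (pm_residues R' (int M)) n * q ^ n) sums inverse L'"
    using sums_partition_count_pm_residues[OF q fin(2) bspec[OF R'] M] by blast
  have "complex_of_real (L' - q ^ k * L) = complex_of_real (e * q ^ j * (L * L'))"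
    using eq[of "complex_of_real q"] q by (simp flip: L(2) L'(2))
  then have "L' - q ^ k * L = e * q ^ j * (L * L')"
    by (simp only: of_real_eq_iff)
  then have "inverse L = e * q ^ j + q ^ k * inverse L'"
    using L(1) L'(1) by (simp add: field_simps)
  with L(3) L'(3) show "\<exists>A B. (\<lambda>n. partition_count (pm_residues R (int M)) n * q ^ n) sums A \<and>
      (\<lambda>n. partition_count (pm_residues R' (int M)) n * q ^ n) sums B \<and> A = e * q ^ j + q ^ k * B"
    by blast
qed

theorem theorem4p2:
  shows
  "(\<forall>S T. S = pm_residues {1, 3, 4, 5, 6, 7, 13, 15, 16, 17, 18, 19} 40 \<longrightarrow>
      T = pm_residues {1, 2, 3, 5, 9, 11, 12, 15, 16, 17, 18, 19} 40 \<longrightarrow>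
      (\<forall>n\<ge>1. partition_count S n = partition_count T (n - 1))) \<and>
   (\<forall>S T. S = pm_residues {3, 4, 5, 6, 7, 8, 9, 11, 13, 14, 15, 17} 40 \<longrightarrow>
      T = pm_residues {1, 3, 5, 8, 9, 11, 12, 14, 15, 17, 18, 19} 40 \<longrightarrow>
      (\<forall>n\<ge>3. partition_count S n = partition_count T (n - 3))) \<and>
   (\<forall>S T. S = pm_residues {1, 3, 4, 5, 6, 7, 8, 13, 14, 15, 17, 19} 40 \<longrightarrow>
      T = pm_residues {1, 2, 5, 6, 7, 8, 9, 11, 12, 13, 15, 19} 40 \<longrightarrow>
      (\<forall>n. n \<noteq> 2 \<longrightarrow> partition_count S n = partition_count T n)) \<and>
   (\<forall>S T. S = pm_residues {2, 3, 4, 5, 7, 9, 11, 13, 14, 15, 16, 17} 40 \<longrightarrow>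
      T = pm_residues {1, 2, 5, 7, 9, 11, 12, 13, 15, 16, 18, 19} 40 \<longrightarrow>
      (\<forall>n\<ge>2. partition_count S n = partition_count T (n - 2)))"
proof (intro conjI allI impI; hypsubst)
  fix n :: nat assume "1 \<le> n"
  \<comment> \<open>Here, as in parts (ii) and (iv), j = 0 lies below the shift, so the correction
    term falls outside the range of \<open>n\<close>.\<close>
  then show "partition_count (pm_residues {1, 3, 4, 5, 6, 7, 13, 15, 16, 17, 18, 19} 40) n =
      partition_count (pm_residues {1, 2, 3, 5, 9, 11, 12, 15, 16, 17, 18, 19} 40) (n - 1)"
    using partition_count_pm_residues_shift[of 40 "{1, 3, 4, 5, 6, 7, 13, 15, 16, 17, 18, 19}"
        "{1, 2, 3, 5, 9, 11, 12, 15, 16, 17, 18, 19}" 1 "1" 0 n, OF _ _ _ _ _ nome.theta_product_1]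
    by (simp add: nome_def)
next
  fix n :: nat assume "3 \<le> n"
  then show "partition_count (pm_residues {3, 4, 5, 6, 7, 8, 9, 11, 13, 14, 15, 17} 40) n =
      partition_count (pm_residues {1, 3, 5, 8, 9, 11, 12, 14, 15, 17, 18, 19} 40) (n - 3)"
    using partition_count_pm_residues_shift[of 40 "{3, 4, 5, 6, 7, 8, 9, 11, 13, 14, 15, 17}"
        "{1, 3, 5, 8, 9, 11, 12, 14, 15, 17, 18, 19}" 3 "1" 0 n, OF _ _ _ _ _ nome.theta_product_2]
    by (simp add: nome_def)
next
  fix n :: nat assume "n \<noteq> 2"
  \<comment> \<open>No shift occurs, and the correction -q^2 affects n = 2 alone.\<close>
  then show "partition_count (pm_residues {1, 3, 4, 5, 6, 7, 8, 13, 14, 15, 17, 19} 40) n =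
      partition_count (pm_residues {1, 2, 5, 6, 7, 8, 9, 11, 12, 13, 15, 19} 40) n"
    using partition_count_pm_residues_shift[of 40 "{1, 3, 4, 5, 6, 7, 8, 13, 14, 15, 17, 19}"
        "{1, 2, 5, 6, 7, 8, 9, 11, 12, 13, 15, 19}" 0 "- 1" 2 n, OF _ _ _ _ _ nome.theta_product_3]
    by (simp add: nome_def)
next
  fix n :: nat assume "2 \<le> n"
  then show "partition_count (pm_residues {2, 3, 4, 5, 7, 9, 11, 13, 14, 15, 16, 17} 40) n =
      partition_count (pm_residues {1, 2, 5, 7, 9, 11, 12, 13, 15, 16, 18, 19} 40) (n - 2)"
    using partition_count_pm_residues_shift[of 40 "{2, 3, 4, 5, 7, 9, 11, 13, 14, 15, 16, 17}"
        "{1, 2, 5, 7, 9, 11, 12, 13, 15, 16, 18, 19}" 2 "1" 0 n, OF _ _ _ _ _ nome.theta_product_4]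
    by (simp add: nome_def)
qed

end
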